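(* Let $\gamma$ be a closed rectifiable curve in $\mathbb{C}$, let $D=\{z\in\mathbb{C}\setminus\gamma : \operatorname{Ind}(\gamma,z)\neq 0\}$, and let $f$ be a holomorphic function on $D$ which is continuous on $D\cup\gamma$. Then $$\int_\gamma f(z)\,dz=0.$$
   Context: A closed rectifiable curve is a continuous complex-valued mapping $\gamma$ of bounded variation defined on the unit circle $\mathbb{T}$ (not assumed injective); the same letter $\gamma$ also denotes the image of $\mathbb{T}$ under the mapping. For $z\notin\gamma$, the index (winding number) is $\operatorname{Ind}(\gamma,z)=\frac{1}{2\pi i}\int_\gamma\frac{dw}{w-z}$. The set $D$ is open, and may be empty. The function $f$ is complex-valued and defined on $D\cup\gamma$. *)

theory Defs
  imports "HOL-Analysis.Analysis"
begin

text \<open>Total variation is bounded over all partitions of the interval. One-point members of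
  a division contribute nothing to the sum, so only genuine subintervals matter.\<close>

definition bounded_variation_on_interval :: "(real \<Rightarrow> complex) \<Rightarrow> real \<Rightarrow> real \<Rightarrow> bool"
  where "bounded_variation_on_interval g a b \<longleftrightarrow>
    (\<exists>B. \<forall>d. d division_of {a..b} \<longrightarrow> (\<Sum>K\<in>d. norm (g (Sup K) - g (Inf K))) \<le> B)"

text \<open>A bounded-variation curve need not be absolutely continuous, so its line integral is not
  given by integrating against the derivative of the curve (as the library's contour integral
  does). It is the Riemann--Stieltjes integral: the limit of the Riemann--Stieltjes
  sums as the mesh tends to 0. The radius of the balls is constant, unlike in the
  Henstock--Kurzweil integral, so that being fine is a condition on the mesh.\<close>

definition has_RS_integral ::
    "(real \<Rightarrow> complex) \<Rightarrow> (real \<Rightarrow> complex) \<Rightarrow> complex \<Rightarrow> real \<Rightarrow> real \<Rightarrow> bool"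
  where "has_RS_integral h g I a b \<longleftrightarrow>
    (\<forall>e>0. \<exists>\<delta>>0. \<forall>p. p tagged_division_of {a..b} \<and> (\<lambda>x. ball x \<delta>) fine p \<longrightarrow>
      norm ((\<Sum>(x, K)\<in>p. h x * (g (Sup K) - g (Inf K))) - I) < e)"

lemma has_RS_integral_unique:
  assumes "has_RS_integral h g I a b" and "has_RS_integral h g J a b"
  shows "I = J"
proof (rule ccontr)
  assume "I \<noteq> J"
  define e where "e = norm (I - J) / 2"
  have "e > 0" using \<open>I \<noteq> J\<close> by (simp add: e_def)
  define S where "S p = (\<Sum>(x, K)\<in>p. h x * (g (Sup K) - g (Inf K)))" for p
  have "\<exists>\<delta>>0. \<forall>p. p tagged_division_of {a..b} \<and> (\<lambda>x. ball x \<delta>) fine p \<longrightarrow> norm (S p - I) < e"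
    using assms(1) \<open>e > 0\<close> unfolding has_RS_integral_def S_def by (elim allE impE)
  then obtain \<delta> where \<delta>: "\<delta> > 0"
    "\<forall>p. p tagged_division_of {a..b} \<and> (\<lambda>x. ball x \<delta>) fine p \<longrightarrow> norm (S p - I) < e"
    by (elim exE conjE)
  have "\<exists>\<eta>>0. \<forall>p. p tagged_division_of {a..b} \<and> (\<lambda>x. ball x \<eta>) fine p \<longrightarrow> norm (S p - J) < e"
    using assms(2) \<open>e > 0\<close> unfolding has_RS_integral_def S_def by (elim allE impE)
  then obtain \<eta> where \<eta>: "\<eta> > 0"
    "\<forall>p. p tagged_division_of {a..b} \<and> (\<lambda>x. ball x \<eta>) fine p \<longrightarrow> norm (S p - J) < e"
    by (elim exE conjE)
  have "gauge (\<lambda>x::real. ball x (min \<delta> \<eta>))"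
    using \<delta>(1) \<eta>(1) by (simp add: gauge_def)
  then obtain p where p: "p tagged_division_of {a..b}" "(\<lambda>x. ball x (min \<delta> \<eta>)) fine p"
    by (rule fine_division_exists_real)
  have "(\<lambda>x. ball x \<delta>) fine p" "(\<lambda>x. ball x \<eta>) fine p"
    using p(2) unfolding fine_def ball_min_Int by blast+
  with p(1) \<delta>(2) \<eta>(2) have "norm (S p - I) < e" "norm (S p - J) < e"
    by blast+
  then have "norm (I - J) < e + e"
    using norm_diff_triangle_less[of I "S p" e J e] by (simp add: norm_minus_commute)
  then show False by (simp add: e_def)
qed

text \<open>A closed curve is a mapping on the unit circle \<open>sphere 0 1\<close>; its values elsewhere are
  irrelevant. The circle is traversed once counterclockwise by \<open>t \<mapsto> cis (2 * pi * t)\<close>, for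
  \<open>t\<close> in the unit interval.\<close>

definition circle_param :: "(complex \<Rightarrow> complex) \<Rightarrow> real \<Rightarrow> complex"
  where "circle_param \<gamma> t = \<gamma> (cis (2 * pi * t))"

definition closed_rectifiable_curve :: "(complex \<Rightarrow> complex) \<Rightarrow> bool"
  where "closed_rectifiable_curve \<gamma> \<longleftrightarrow>
    continuous_on (sphere 0 1) \<gamma> \<and> bounded_variation_on_interval (circle_param \<gamma>) 0 1"

definition curve_image :: "(complex \<Rightarrow> complex) \<Rightarrow> complex set"
  where "curve_image \<gamma> = \<gamma> ` sphere 0 1"

definition has_curve_integral ::
    "(complex \<Rightarrow> complex) \<Rightarrow> complex \<Rightarrow> (complex \<Rightarrow> complex) \<Rightarrow> bool"
    (infixr \<open>has'_curve'_integral\<close> 50)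
  where "(f has_curve_integral I) \<gamma> \<longleftrightarrow>
    has_RS_integral (\<lambda>t. f (circle_param \<gamma> t)) (circle_param \<gamma>) I 0 1"

definition curve_integral :: "(complex \<Rightarrow> complex) \<Rightarrow> (complex \<Rightarrow> complex) \<Rightarrow> complex"
  where "curve_integral \<gamma> f = (THE I. (f has_curve_integral I) \<gamma>)"

lemma curve_integral_unique: "(f has_curve_integral I) \<gamma> \<Longrightarrow> curve_integral \<gamma> f = I"
  unfolding curve_integral_def has_curve_integral_def
  by (blast intro: has_RS_integral_unique)

definition curve_index :: "(complex \<Rightarrow> complex) \<Rightarrow> complex \<Rightarrow> complex"
  where "curve_index \<gamma> z = 1 / (2 * pi * \<i>) * curve_integral \<gamma> (\<lambda>w. 1 / (w - z))"

end

(* Extend f to a uniformly continuous F on the plane and round the curve to a closed path on a square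
   grid of mesh d whose length is bounded independently of d. Summation by parts turns the integral
   of F over this path into a sum of w(Q) times the integral of F around Q, over the grid squares Q,
   where w is the winding number of the rounded path. If Q is further than a fixed multiple of d from
   the curve, then w(Q) is the index of the curve on Q; so if w(Q) is not 0, Q lies in D and Cauchy's
   theorem applies. Only O(1/d) squares remain, each contributing o(d), but with unbounded weights w.
   Therefore w is decomposed into the indicators of its superlevel sets E, whose perimeters add up to
   at most the length of the path. A set E of perimeter at most eta contributes at most its perimeter
   times the oscillation of F at scale eta; the number of the other sets E is bounded independently
   of d, and each of them contributes o(1) as d tends to 0. *)

theory Submission
  imports Defs "HOL-Complex_Analysis.Complex_Analysis"
begin

section \<open>Grid functions and their superlevel sets\<close>

text \<open>The index of a rectifiable curve may be unbounded, so the squares met by the curve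
  cannot be dismissed by counting them. What is controlled is the total perimeter of the superlevel
  sets of w. A single modulus of continuity would not do: each large set is charged for up to O(1/d)
  squares, and there are up to O(1 / \<eta>) large sets. Hence the order of choice: the oscillation
  \<open>e1\<close> and its scale \<eta>, then \<open>e2\<close>, small even after division by
  \<eta>, then d, and last the fineness \<delta> of the divisions. All estimates concern
  Riemann-Stieltjes sums and hold for every sufficiently fine division, so the existence of the
  integral comes with its value. Levels run from 1 upwards, separately for w and - w, so that w
  vanishes nowhere on the sets E: away from the curve, F is known to be holomorphic only where the
  index is not 0. The index itself is a Riemann-Stieltjes integral; comparison with a continuous
  logarithm identifies it with the topological winding number.\<close>

lemma sum_cyclic_by_parts:
  fixes a b :: "nat \<Rightarrow> 'a::comm_ring"
  assumes "a M = a 0" and "b M = b 0"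
  shows "(\<Sum>k<M. a k * (b (Suc k) - b k)) = - (\<Sum>k<M. (a (Suc k) - a k) * b (Suc k))"
proof -
  have "(\<Sum>k<M. a k * (b (Suc k) - b k)) + (\<Sum>k<M. (a (Suc k) - a k) * b (Suc k))
      = (\<Sum>k<M. a (Suc k) * b (Suc k) - a k * b k)"
    by (simp add: sum.distrib [symmetric] algebra_simps)
  also have "\<dots> = 0"
    using assms by (simp add: sum_lessThan_telescope[of "\<lambda>k. a k * b k"])
  finally show ?thesis by (simp add: eq_neg_iff_add_eq_0)
qed

text \<open>Shifting the index moves one term across each end of the box; these two terms carry the
  factors \<open>a (- R - 1)\<close> and \<open>a R\<close>.\<close>

lemma sum_box_by_parts:
  fixes a c :: "int \<Rightarrow> 'a::comm_ring"
  assumes "a (- R - 1) = 0" and "a R = 0" and "R \<ge> 0"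
  shows "(\<Sum>j\<in>{-R..R}. a j * (c j - c (j + 1))) = (\<Sum>j\<in>{-R..R}. (a j - a (j - 1)) * c j)"
proof -
  have "(\<Sum>j\<in>{-R..R}. a j * c (j + 1)) = (\<Sum>j\<in>{-R+1..R+1}. a (j - 1) * c j)"
    by (rule sum.reindex_bij_witness[of _ "\<lambda>j. j - 1" "\<lambda>j. j + 1"]) auto
  also have "\<dots> = (\<Sum>j\<in>{-R..R+1}. a (j - 1) * c j)"
  proof (rule sum.mono_neutral_left)
    show "\<forall>j\<in>{-R..R+1} - {-R+1..R+1}. a (j - 1) * c j = 0"
    proof
      fix j assume "j \<in> {-R..R+1} - {-R+1..R+1}"
      then have "j = - R" by auto
      then show "a (j - 1) * c j = 0" using assms by simp
    qed
  qed auto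
  also have "\<dots> = (\<Sum>j\<in>{-R..R}. a (j - 1) * c j)"
  proof (rule sum.mono_neutral_right)
    show "\<forall>j\<in>{-R..R+1} - {-R..R}. a (j - 1) * c j = 0"
    proof
      fix j assume "j \<in> {-R..R+1} - {-R..R}"
      then have "j = R + 1" by auto
      then show "a (j - 1) * c j = 0" using assms by simp
    qed
  qed auto
  finally show ?thesis
    by (simp add: right_diff_distrib left_diff_distrib sum_subtractf)
qed

text \<open>The 1-form with values \<open>H\<close> and \<open>V\<close> on the horizontal and vertical grid edges starting at
  \<open>(i, j)\<close>, integrated around the unit square whose lower left corner is \<open>(i, j)\<close>.\<close>

definition cell :: "(int \<Rightarrow> int \<Rightarrow> complex) \<Rightarrow> (int \<Rightarrow> int \<Rightarrow> complex) \<Rightarrow> int \<Rightarrow> int \<Rightarrow> complex"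
  where "cell H V i j = H i j + V (i + 1) j - H i (j + 1) - V i j"

text \<open>The strict bounds leave a margin of one: the upper and right edges of a square of the
  support still have index at most \<open>R\<close>, so sums over \<open>{-R..R}\<close> meet every
  boundary edge.\<close>

definition supported_in :: "int \<Rightarrow> (int \<Rightarrow> int \<Rightarrow> int) \<Rightarrow> bool"
  where "supported_in R u \<longleftrightarrow> (\<forall>i j. u i j \<noteq> 0 \<longrightarrow> \<bar>i\<bar> < R \<and> \<bar>j\<bar> < R)"

lemma supported_inD: "supported_in R u \<Longrightarrow> \<bar>i\<bar> \<ge> R \<or> \<bar>j\<bar> \<ge> R \<Longrightarrow> u i j = 0"
  unfolding supported_in_def by (meson linorder_not_less)

text \<open>Green's formula on the grid: an edge bounds two squares that traverse it in opposite
  directions, so its coefficient is the jump of \<open>u\<close> across it.\<close>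

lemma sum_cell_by_parts:
  assumes "supported_in R u" and "R \<ge> 0"
  shows "(\<Sum>i\<in>{-R..R}. \<Sum>j\<in>{-R..R}. of_int (u i j) * cell H V i j) =
    (\<Sum>i\<in>{-R..R}. \<Sum>j\<in>{-R..R}.
       of_int (u i j - u i (j - 1)) * H i j + of_int (u (i - 1) j - u i j) * V i j)"
proof -
  have h: "(\<Sum>j\<in>{-R..R}. of_int (u i j) * (H i j - H i (j + 1)))
      = (\<Sum>j\<in>{-R..R}. of_int (u i j - u i (j - 1)) * H i j)" for i
    using sum_box_by_parts[of "\<lambda>j. of_int (u i j)" R "\<lambda>j. H i j"] supported_inD[OF assms(1)] assms(2)
    by simp
  have v: "(\<Sum>i\<in>{-R..R}. of_int (u i j) * (V i j - V (i + 1) j))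
      = (\<Sum>i\<in>{-R..R}. of_int (u i j - u (i - 1) j) * V i j)" for j
    using sum_box_by_parts[of "\<lambda>i. of_int (u i j)" R "\<lambda>i. V i j"] supported_inD[OF assms(1)] assms(2)
    by simp
  have "(\<Sum>i\<in>{-R..R}. \<Sum>j\<in>{-R..R}. of_int (u i j) * cell H V i j) =
     (\<Sum>i\<in>{-R..R}. \<Sum>j\<in>{-R..R}. of_int (u i j) * (H i j - H i (j + 1)))
     - (\<Sum>j\<in>{-R..R}. \<Sum>i\<in>{-R..R}. of_int (u i j) * (V i j - V (i + 1) j))"
    by (subst (2) sum.swap) (simp add: cell_def sum_subtractf[symmetric] algebra_simps)
  also have "\<dots> = (\<Sum>i\<in>{-R..R}. \<Sum>j\<in>{-R..R}. of_int (u i j - u i (j - 1)) * H i j)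
     - (\<Sum>i\<in>{-R..R}. \<Sum>j\<in>{-R..R}. of_int (u i j - u (i - 1) j) * V i j)"
    unfolding h v by (subst (2) sum.swap) simp
  finally show ?thesis
    by (simp add: sum_subtractf[symmetric] algebra_simps)
qed

text \<open>For the indicator function of a finite set of squares this is its perimeter.\<close>

definition tv :: "int \<Rightarrow> (int \<Rightarrow> int \<Rightarrow> int) \<Rightarrow> int"
  where "tv R u = (\<Sum>i\<in>{-R..R}. \<Sum>j\<in>{-R..R}. \<bar>u i j - u i (j - 1)\<bar> + \<bar>u (i - 1) j - u i j\<bar>)"

lemma norm_sum_cell_le:
  assumes "supported_in R u" and "R \<ge> 0" and "c \<ge> 0"
    and "\<And>i j. u i j \<noteq> u i (j - 1) \<Longrightarrow> norm (H i j) \<le> c"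
    and "\<And>i j. u (i - 1) j \<noteq> u i j \<Longrightarrow> norm (V i j) \<le> c"
  shows "norm (\<Sum>i\<in>{-R..R}. \<Sum>j\<in>{-R..R}. of_int (u i j) * cell H V i j) \<le> c * tv R u"
proof -
  have 1: "norm (of_int (u i j - u i (j - 1)) * H i j + of_int (u (i - 1) j - u i j) * V i j)
     \<le> c * of_int (\<bar>u i j - u i (j - 1)\<bar> + \<bar>u (i - 1) j - u i j\<bar>)" for i j
  proof -
    have "norm (of_int (u i j - u i (j - 1)) * H i j) \<le> of_int \<bar>u i j - u i (j - 1)\<bar> * c"
    proof (cases "u i j = u i (j - 1)")
      case False
      then show ?thesis using assms(4)[OF False]
        by (simp only: norm_mult norm_of_int of_int_abs) (rule mult_left_mono, auto)
    qed simp
    moreover have "norm (of_int (u (i - 1) j - u i j) * V i j) \<le> of_int \<bar>u (i - 1) j - u i j\<bar> * c"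
    proof (cases "u (i - 1) j = u i j")
      case False
      then show ?thesis using assms(5)[OF False]
        by (simp only: norm_mult norm_of_int of_int_abs) (rule mult_left_mono, auto)
    qed simp
    ultimately show ?thesis
      by (intro norm_triangle_le) (simp add: algebra_simps)
  qed
  have "norm (\<Sum>i\<in>{-R..R}. \<Sum>j\<in>{-R..R}. of_int (u i j) * cell H V i j)
     \<le> (\<Sum>i\<in>{-R..R}. \<Sum>j\<in>{-R..R}. c * of_int (\<bar>u i j - u i (j - 1)\<bar> + \<bar>u (i - 1) j - u i j\<bar>))"
    unfolding sum_cell_by_parts[OF assms(1,2)] by (intro sum_norm_le 1)
  also have "\<dots> = c * tv R u"
    by (simp add: tv_def sum_distrib_left)
  finally show ?thesis .
qed

section \<open>Layer cake decomposition of integer-valued grid functions\<close>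

lemma int_layer_cake:
  fixes u :: int
  assumes "0 \<le> u" and "u \<le> N"
  shows "(\<Sum>n\<in>{1..N}. of_bool (n \<le> u)) = u"
proof -
  have "{1..N} \<inter> {n. n \<le> u} = {1..u}" using assms by auto
  then show ?thesis using assms by simp
qed

lemma int_layer_cake_diff:
  fixes u v :: int
  assumes "0 \<le> u" "u \<le> N" "0 \<le> v" "v \<le> N"
  shows "(\<Sum>n\<in>{1..N}. \<bar>of_bool (n \<le> u) - of_bool (n \<le> v)\<bar>) = \<bar>u - v\<bar>"
proof -
  have *: "(\<Sum>n\<in>{1..N}. \<bar>of_bool (n \<le> a) - of_bool (n \<le> b)\<bar>) = \<bar>a - b\<bar>"
    if "b \<le> a" "0 \<le> a" "a \<le> N" "0 \<le> b" "b \<le> N" for a b :: int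
  proof -
    have "(\<Sum>n\<in>{1..N}. \<bar>of_bool (n \<le> a) - of_bool (n \<le> b)\<bar>)
      = (\<Sum>n\<in>{1..N}. of_bool (n \<le> a) - of_bool (n \<le> b) :: int)"
      using that by (intro sum.cong) auto
    then show ?thesis using that by (simp add: sum_subtractf int_layer_cake del: sum_of_bool_eq)
  qed
  show ?thesis
    using *[of u v] *[of v u] assms by (cases "v \<le> u") (auto simp: abs_minus_commute)
qed

text \<open>A discrete coarea formula: a value is the number of levels up to it, and a jump is the
  number of levels between two values. An estimate linear in the perimeter therefore passes from
  sets to functions with the same constant.\<close>

lemma norm_sum_layer_cake:
  fixes q :: "int \<Rightarrow> int \<Rightarrow> complex" and c :: real
  assumes nonneg: "\<And>i j. u i j \<ge> 0"
    and le: "\<And>n. n \<ge> 1 \<Longrightarrow>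
      norm (\<Sum>i\<in>{-R..R}. \<Sum>j\<in>{-R..R}. of_int (of_bool (n \<le> u i j)) * q i j)
        \<le> c * tv R (\<lambda>i j. of_bool (n \<le> u i j))"
  shows "norm (\<Sum>i\<in>{-R..R}. \<Sum>j\<in>{-R..R}. of_int (u i j) * q i j) \<le> c * tv R u"
proof -
  \<comment> \<open>The box is enlarged by one because \<open>tv\<close> also looks at the index
    \<open>- R - 1\<close>; the element 0 keeps the set nonempty for every \<open>R\<close>.\<close>
  define N where "N = Max ((\<lambda>(i, j). u i j) ` ({-R-1..R} \<times> {-R-1..R}) \<union> {0})"
  have N: "u i j \<le> N" if "i \<in> {-R-1..R}" "j \<in> {-R-1..R}" for i j
    unfolding N_def using that by (intro Max_ge) force+
  have 1: "(\<Sum>i\<in>{-R..R}. \<Sum>j\<in>{-R..R}. of_int (u i j) * q i j) =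
    (\<Sum>n\<in>{1..N}. \<Sum>i\<in>{-R..R}. \<Sum>j\<in>{-R..R}. of_int (of_bool (n \<le> u i j)) * q i j)"
  proof -
    have "(\<Sum>i\<in>{-R..R}. \<Sum>j\<in>{-R..R}. of_int (u i j) * q i j) =
       (\<Sum>i\<in>{-R..R}. \<Sum>j\<in>{-R..R}. \<Sum>n\<in>{1..N}. of_int (of_bool (n \<le> u i j)) * q i j)"
    proof (intro sum.cong refl)
      fix i j assume "i \<in> {-R..R}" "j \<in> {-R..R}"
      then have "u i j = (\<Sum>n\<in>{1..N}. of_bool (n \<le> u i j))"
        using int_layer_cake[of "u i j" N] N[of i j] nonneg by simp
      then have "complex_of_int (u i j) = (\<Sum>n\<in>{1..N}. of_int (of_bool (n \<le> u i j)))"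
        by (metis of_int_sum)
      then show "of_int (u i j) * q i j = (\<Sum>n\<in>{1..N}. of_int (of_bool (n \<le> u i j)) * q i j)"
        by (metis sum_distrib_right)
    qed
    also have "\<dots> = (\<Sum>i\<in>{-R..R}. \<Sum>n\<in>{1..N}. \<Sum>j\<in>{-R..R}. of_int (of_bool (n \<le> u i j)) * q i j)"
      by (intro sum.cong refl sum.swap)
    also have "\<dots> = (\<Sum>n\<in>{1..N}. \<Sum>i\<in>{-R..R}. \<Sum>j\<in>{-R..R}. of_int (of_bool (n \<le> u i j)) * q i j)"
      by (rule sum.swap)
    finally show ?thesis .
  qed
  have 2: "(\<Sum>n\<in>{1..N}. tv R (\<lambda>i j. of_bool (n \<le> u i j))) = tv R u"
  proof -
    have "(\<Sum>n\<in>{1..N}. tv R (\<lambda>i j. of_bool (n \<le> u i j))) =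
      (\<Sum>i\<in>{-R..R}. \<Sum>j\<in>{-R..R}. \<Sum>n\<in>{1..N}.
         \<bar>of_bool (n \<le> u i j) - of_bool (n \<le> u i (j - 1))\<bar>
         + \<bar>of_bool (n \<le> u (i - 1) j) - of_bool (n \<le> u i j)\<bar>)"
      unfolding tv_def
      by (subst sum.swap) (intro sum.cong refl sum.swap)
    also have "\<dots> = tv R u"
      unfolding tv_def sum.distrib[where A = "{1..N}"]
      by (intro sum.cong refl arg_cong2[where f = "(+)"] int_layer_cake_diff nonneg N) auto
    finally show ?thesis .
  qed
  show ?thesis
    unfolding 1 2[symmetric] of_int_sum sum_distrib_left by (intro sum_norm_le le) auto
qed

text \<open>The signs are separated because the superlevel sets of \<open>w\<close> at levels below
  1 contain all squares where \<open>w\<close> is 0. Positive and negative part are 1-Lipschitz in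
  \<open>w\<close>, so each has at most the variation of \<open>w\<close>; hence the factor
  2.\<close>

lemma norm_sum_cells_signed_le:
  fixes q :: "int \<Rightarrow> int \<Rightarrow> complex" and c :: real
  assumes "c \<ge> 0"
    and pos: "\<And>n. n \<ge> 1 \<Longrightarrow>
      norm (\<Sum>i\<in>{-R..R}. \<Sum>j\<in>{-R..R}. of_int (of_bool (n \<le> w i j)) * q i j)
        \<le> c * tv R (\<lambda>i j. of_bool (n \<le> w i j))"
    and neg: "\<And>n. n \<ge> 1 \<Longrightarrow>
      norm (\<Sum>i\<in>{-R..R}. \<Sum>j\<in>{-R..R}. of_int (of_bool (n \<le> - w i j)) * q i j)
        \<le> c * tv R (\<lambda>i j. of_bool (n \<le> - w i j))"
  shows "norm (\<Sum>i\<in>{-R..R}. \<Sum>j\<in>{-R..R}. of_int (w i j) * q i j) \<le> 2 * c * tv R w"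
proof -
  define a where "a i j = max (w i j) 0" for i j
  define b where "b i j = max (- w i j) 0" for i j
  have w: "w i j = a i j - b i j" for i j by (simp add: a_def b_def max_def)
  have la: "(n \<le> a i j) = (n \<le> w i j)" "(n \<le> b i j) = (n \<le> - w i j)" if "n \<ge> 1" for n i j
    using that by (auto simp: a_def b_def max_def)
  have A: "norm (\<Sum>i\<in>{-R..R}. \<Sum>j\<in>{-R..R}. of_int (a i j) * q i j) \<le> c * tv R a"
  proof (rule norm_sum_layer_cake)
    show "0 \<le> a i j" for i j by (simp add: a_def)
  qed (simp only: la pos)
  have B: "norm (\<Sum>i\<in>{-R..R}. \<Sum>j\<in>{-R..R}. of_int (b i j) * q i j) \<le> c * tv R b"
  proof (rule norm_sum_layer_cake)
    show "0 \<le> b i j" for i j by (simp add: b_def)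
  qed (simp only: la neg)
  have lip: "\<bar>a i j - a k l\<bar> \<le> \<bar>w i j - w k l\<bar>" "\<bar>b i j - b k l\<bar> \<le> \<bar>w i j - w k l\<bar>" for i j k l
    unfolding a_def b_def by linarith+
  have "tv R a \<le> tv R w" "tv R b \<le> tv R w"
    unfolding tv_def by (intro sum_mono add_mono lip)+
  then have ab: "c * of_int (tv R a) \<le> c * of_int (tv R w)" "c * of_int (tv R b) \<le> c * of_int (tv R w)"
    using \<open>c \<ge> 0\<close> by (intro mult_left_mono; simp)+
  have "(\<Sum>i\<in>{-R..R}. \<Sum>j\<in>{-R..R}. of_int (w i j) * q i j)
     = (\<Sum>i\<in>{-R..R}. \<Sum>j\<in>{-R..R}. of_int (a i j) * q i j)
       - (\<Sum>i\<in>{-R..R}. \<Sum>j\<in>{-R..R}. of_int (b i j) * q i j)"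
    by (simp add: w sum_subtractf left_diff_distrib)
  then have "norm (\<Sum>i\<in>{-R..R}. \<Sum>j\<in>{-R..R}. of_int (w i j) * q i j)
      \<le> c * tv R a + c * tv R b"
    by (simp only:) (rule order_trans[OF norm_triangle_ineq4 add_mono[OF A B]])
  then show ?thesis
    using ab by linarith
qed

section \<open>Lattice loops\<close>

text \<open>The coefficient of the unit edge from i to i + 1 in the chain from x to x': 1 or -1
  according to the direction of travel, and 0 off the way. A difference of two half-line indicators
  covers both directions at once.\<close>

definition interval_diff :: "int \<Rightarrow> int \<Rightarrow> int \<Rightarrow> int"
  where "interval_diff x x' i = of_bool (i < x') - of_bool (i < x)"

text \<open>The chain from x to x' is the difference of the chains from \<open>- R\<close> to x' and
  from \<open>- R\<close> to x, and each of these telescopes.\<close>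

lemma sum_interval_diff_telescope:
  fixes a :: "int \<Rightarrow> 'a::comm_ring_1"
  assumes "\<bar>x\<bar> \<le> R" and "\<bar>x'\<bar> \<le> R"
  shows "(\<Sum>i\<in>{-R..R}. of_int (interval_diff x x' i) * (a (i + 1) - a i)) = a x' - a x"
proof -
  have *: "(\<Sum>i\<in>{-R..R}. of_int (of_bool (i < y)) * (a (i + 1) - a i)) = a y - a (- R)" if "\<bar>y\<bar> \<le> R" for y
  proof -
    have "(\<Sum>i\<in>{-R..R}. of_int (of_bool (i < y)) * (a (i + 1) - a i)) = (\<Sum>i\<in>{-R..<y}. a (i + 1) - a i)"
      by (rule sum.mono_neutral_cong_right) (use that in auto)
    also have "\<dots> = a y - a (- R)"
    proof -
      have "-R \<le> y" using that by simp
      then show ?thesis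
      proof (induction y rule: int_ge_induct)
        case (step y)
        then have "{-R..<y+1} = insert y {-R..<y}" by auto
        then show ?case using step by simp
      qed simp
    qed
    finally show ?thesis .
  qed
  have "(\<Sum>i\<in>{-R..R}. of_int (interval_diff x x' i) * (a (i + 1) - a i))
     = (\<Sum>i\<in>{-R..R}. of_int (of_bool (i < x')) * (a (i + 1) - a i))
      - (\<Sum>i\<in>{-R..R}. of_int (of_bool (i < x)) * (a (i + 1) - a i))"
    by (simp only: interval_diff_def of_int_diff left_diff_distrib sum_subtractf)
  then show ?thesis using assms by (simp only: *) simp
qed

lemma sum_interval_diff:
  assumes "\<bar>x\<bar> \<le> R" and "\<bar>x'\<bar> \<le> R"
  shows "(\<Sum>i\<in>{-R..R}. interval_diff x x' i) = x' - x"
  using sum_interval_diff_telescope[OF assms, of "\<lambda>i. i"] by simp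

lemma sum_abs_interval_diff:
  assumes "\<bar>x\<bar> \<le> R" and "\<bar>x'\<bar> \<le> R"
  shows "(\<Sum>i\<in>{-R..R}. \<bar>interval_diff x x' i\<bar>) = \<bar>x' - x\<bar>"
proof (cases "x \<le> x'")
  case True
  then have "\<bar>interval_diff x x' i\<bar> = interval_diff x x' i" for i
    by (auto simp: interval_diff_def)
  then show ?thesis using True sum_interval_diff[OF assms] by simp
next
  case False
  then have "\<bar>interval_diff x x' i\<bar> = - interval_diff x x' i" for i
    by (auto simp: interval_diff_def)
  then show ?thesis using False sum_interval_diff[OF assms] by (simp add: sum_negf)
qed

lemma interval_diff_nonzeroD:
  "interval_diff x x' i \<noteq> 0 \<Longrightarrow> (x \<le> i \<and> i < x') \<or> (x' \<le> i \<and> i < x)"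
  by (auto simp: interval_diff_def split: if_splits)

text \<open>Steps may have any length, including 0: a step stands for an L-shaped path of unit
  edges, resolved by \<open>interval_diff\<close> in each coordinate.\<close>

locale lattice_loop =
  fixes X Y :: "nat \<Rightarrow> int" and M :: nat and R :: int
  assumes closedX: "X M = X 0" and closedY: "Y M = Y 0"
    and boundX: "\<And>k. \<bar>X k\<bar> < R" and boundY: "\<And>k. \<bar>Y k\<bar> < R"
begin

lemma R_pos: "R > 0" using boundX[of 0] by linarith

text \<open>The signed number of times that the loop crosses the vertical half-line going down from the
  square \<open>(i, j)\<close>, where the step from \<open>k\<close> to \<open>Suc k\<close> moves first horizontally and then
  vertically.\<close>

definition wind :: "int \<Rightarrow> int \<Rightarrow> int"
  where "wind i j = (\<Sum>k<M. of_bool (Y k \<le> j) * interval_diff (X k) (X (Suc k)) i)"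

definition len :: int
  where "len = (\<Sum>k<M. \<bar>X (Suc k) - X k\<bar> + \<bar>Y (Suc k) - Y k\<bar>)"

lemma wind_supported: "supported_in R wind"
  unfolding supported_in_def
proof (intro allI impI, rule ccontr)
  fix i j assume nz: "wind i j \<noteq> 0" and "\<not> (\<bar>i\<bar> < R \<and> \<bar>j\<bar> < R)"
  then consider "i \<ge> R" | "i \<le> - R" | "j \<ge> R" | "j \<le> - R" by linarith
  then show False
  proof cases
    case 1
    then have "\<not> i < X k" for k using boundX[of k] by linarith
    then show False using nz by (simp add: wind_def interval_diff_def)
  next
    case 2
    then have "i < X k" for k using boundX[of k] by linarith
    then show False using nz by (simp add: wind_def interval_diff_def)
  next
    case 3
    then have "Y k \<le> j" for k using boundY[of k] by linarith
    \<comment> \<open>Above the loop every horizontal edge is counted, and closedness makes the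
      signed total vanish.\<close>
    then have "wind i j = (\<Sum>k<M. of_bool (i < X (Suc k)) - of_bool (i < X k))"
      by (simp add: wind_def interval_diff_def)
    also have "\<dots> = 0" using closedX sum_lessThan_telescope[of "\<lambda>k. of_bool (i < X k) :: int" M] by simp
    finally show False using nz by simp
  next
    case 4
    then have "\<not> Y k \<le> j" for k using boundY[of k] by linarith
    then show False using nz by (simp add: wind_def)
  qed
qed

lemma wind_diff_below:
  "wind i j - wind i (j - 1) = (\<Sum>k<M. of_bool (Y k = j) * interval_diff (X k) (X (Suc k)) i)"
  unfolding wind_def sum_subtractf[symmetric] left_diff_distrib[symmetric]
  by (intro sum.cong refl arg_cong2[where f = "(*)"]) auto

text \<open>\<open>wind\<close> counts horizontal edges only; that its differences in the other
  direction count vertical ones is due to closedness, through cyclic summation by parts.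
  \<open>X (Suc k)\<close> appears because the vertical leg of a step comes after the horizontal
  one.\<close>

lemma wind_diff_left:
  "wind (i - 1) j - wind i j = (\<Sum>k<M. of_bool (X (Suc k) = i) * interval_diff (Y k) (Y (Suc k)) j)"
proof -
  have e: "interval_diff (X k) (X (Suc k)) (i - 1) - interval_diff (X k) (X (Suc k)) i
     = of_bool (X (Suc k) = i) - of_bool (X k = i)" for k
    by (auto simp: interval_diff_def)
  have "wind (i - 1) j - wind i j = (\<Sum>k<M. of_bool (Y k \<le> j) * (of_bool (X (Suc k) = i) - of_bool (X k = i)))"
    unfolding wind_def sum_subtractf[symmetric] right_diff_distrib[symmetric] e by simp
  also have "\<dots> = - (\<Sum>k<M. (of_bool (Y (Suc k) \<le> j) - of_bool (Y k \<le> j)) * of_bool (X (Suc k) = i))"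
    using closedX closedY by (intro sum_cyclic_by_parts) simp_all
  also have "\<dots> = (\<Sum>k<M. of_bool (X (Suc k) = i) * interval_diff (Y k) (Y (Suc k)) j)"
    unfolding sum_negf[symmetric]
    by (intro sum.cong refl) (auto simp: interval_diff_def)
  finally show ?thesis .
qed

text \<open>Green's formula for the loop, whose right-hand side is the integral of the 1-form along
  the L-shaped steps: the jump of \<open>wind\<close> across an edge is the signed number of
  passages along it.\<close>

lemma sum_wind_cell:
  "(\<Sum>i\<in>{-R..R}. \<Sum>j\<in>{-R..R}. of_int (wind i j) * cell H V i j) =
   (\<Sum>k<M. (\<Sum>i\<in>{-R..R}. of_int (interval_diff (X k) (X (Suc k)) i) * H i (Y k))
         + (\<Sum>j\<in>{-R..R}. of_int (interval_diff (Y k) (Y (Suc k)) j) * V (X (Suc k)) j))"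
proof -
  have pick: "(\<Sum>j\<in>{-R..R}. of_bool (y = j) * f j) = f y" if "\<bar>y\<bar> < R" for y and f :: "int \<Rightarrow> complex"
  proof -
    have "(\<Sum>j\<in>{-R..R}. of_bool (y = j) * f j) = (\<Sum>j\<in>{-R..R}. if y = j then f j else 0)"
      by (intro sum.cong) auto
    moreover have "y \<in> {-R..R}" using that by auto
    ultimately show ?thesis by simp
  qed
  have "(\<Sum>i\<in>{-R..R}. \<Sum>j\<in>{-R..R}. of_int (wind i j) * cell H V i j) =
    (\<Sum>i\<in>{-R..R}. \<Sum>j\<in>{-R..R}. \<Sum>k<M. of_bool (Y k = j) * (of_int (interval_diff (X k) (X (Suc k)) i) * H i j))
    + (\<Sum>i\<in>{-R..R}. \<Sum>j\<in>{-R..R}. \<Sum>k<M. of_bool (X (Suc k) = i) * (of_int (interval_diff (Y k) (Y (Suc k)) j) * V i j))"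
    using R_pos
    by (subst sum_cell_by_parts[OF wind_supported])
       (simp_all add: wind_diff_below wind_diff_left sum.distrib sum_distrib_right mult.assoc)
  also have "(\<Sum>i\<in>{-R..R}. \<Sum>j\<in>{-R..R}. \<Sum>k<M. of_bool (Y k = j) * (of_int (interval_diff (X k) (X (Suc k)) i) * H i j))
    = (\<Sum>i\<in>{-R..R}. \<Sum>k<M. \<Sum>j\<in>{-R..R}. of_bool (Y k = j) * (of_int (interval_diff (X k) (X (Suc k)) i) * H i j))"
    by (intro sum.cong refl sum.swap)
  also have "\<dots> = (\<Sum>i\<in>{-R..R}. \<Sum>k<M. of_int (interval_diff (X k) (X (Suc k)) i) * H i (Y k))"
    by (intro sum.cong refl pick boundY)
  also have "\<dots> = (\<Sum>k<M. \<Sum>i\<in>{-R..R}. of_int (interval_diff (X k) (X (Suc k)) i) * H i (Y k))"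
    by (rule sum.swap)
  also have "(\<Sum>i\<in>{-R..R}. \<Sum>j\<in>{-R..R}. \<Sum>k<M. of_bool (X (Suc k) = i) * (of_int (interval_diff (Y k) (Y (Suc k)) j) * V i j))
    = (\<Sum>i\<in>{-R..R}. \<Sum>k<M. \<Sum>j\<in>{-R..R}. of_bool (X (Suc k) = i) * (of_int (interval_diff (Y k) (Y (Suc k)) j) * V i j))"
    by (intro sum.cong refl sum.swap)
  also have "\<dots> = (\<Sum>k<M. \<Sum>i\<in>{-R..R}. \<Sum>j\<in>{-R..R}. of_bool (X (Suc k) = i) * (of_int (interval_diff (Y k) (Y (Suc k)) j) * V i j))"
    by (rule sum.swap)
  also have "\<dots> = (\<Sum>k<M. \<Sum>j\<in>{-R..R}. \<Sum>i\<in>{-R..R}. of_bool (X (Suc k) = i) * (of_int (interval_diff (Y k) (Y (Suc k)) j) * V i j))"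
    by (intro sum.cong refl sum.swap)
  also have "\<dots> = (\<Sum>k<M. \<Sum>j\<in>{-R..R}. of_int (interval_diff (Y k) (Y (Suc k)) j) * V (X (Suc k)) j)"
    by (intro sum.cong refl pick boundX)
  finally show ?thesis by (simp only: sum.distrib)
qed

text \<open>Each jump of \<open>wind\<close> is a signed count of passages along one edge, and
  \<open>len\<close> counts all passages without sign.\<close>

lemma tv_wind_le: "tv R wind \<le> len"
proof -
  have pick: "(\<Sum>j\<in>{-R..R}. of_bool (y = j) * c) = c" if "\<bar>y\<bar> < R" for y c :: int
  proof -
    have "(\<Sum>j\<in>{-R..R}. of_bool (y = j) * c) = (\<Sum>j\<in>{-R..R}. if y = j then c else 0)"
      by (intro sum.cong) auto
    moreover have "y \<in> {-R..R}" using that by auto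
    ultimately show ?thesis by simp
  qed
  have "(\<Sum>i\<in>{-R..R}. \<Sum>j\<in>{-R..R}. \<bar>wind i j - wind i (j - 1)\<bar>)
     \<le> (\<Sum>i\<in>{-R..R}. \<Sum>j\<in>{-R..R}. \<Sum>k<M. of_bool (Y k = j) * \<bar>interval_diff (X k) (X (Suc k)) i\<bar>)"
    unfolding wind_diff_below
    by (intro sum_mono order_trans[OF sum_abs]) (simp add: abs_mult)
  also have "\<dots> = (\<Sum>i\<in>{-R..R}. \<Sum>k<M. \<Sum>j\<in>{-R..R}. of_bool (Y k = j) * \<bar>interval_diff (X k) (X (Suc k)) i\<bar>)"
    by (intro sum.cong refl sum.swap)
  also have "\<dots> = (\<Sum>i\<in>{-R..R}. \<Sum>k<M. \<bar>interval_diff (X k) (X (Suc k)) i\<bar>)"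
    by (intro sum.cong refl pick boundY)
  also have "\<dots> = (\<Sum>k<M. \<Sum>i\<in>{-R..R}. \<bar>interval_diff (X k) (X (Suc k)) i\<bar>)"
    by (rule sum.swap)
  also have "\<dots> = (\<Sum>k<M. \<bar>X (Suc k) - X k\<bar>)"
    by (intro sum.cong refl sum_abs_interval_diff less_imp_le[OF boundX])
  finally have 1: "(\<Sum>i\<in>{-R..R}. \<Sum>j\<in>{-R..R}. \<bar>wind i j - wind i (j - 1)\<bar>) \<le> (\<Sum>k<M. \<bar>X (Suc k) - X k\<bar>)" .
  have "(\<Sum>i\<in>{-R..R}. \<Sum>j\<in>{-R..R}. \<bar>wind (i - 1) j - wind i j\<bar>)
     \<le> (\<Sum>i\<in>{-R..R}. \<Sum>j\<in>{-R..R}. \<Sum>k<M. of_bool (X (Suc k) = i) * \<bar>interval_diff (Y k) (Y (Suc k)) j\<bar>)"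
    unfolding wind_diff_left
    by (intro sum_mono order_trans[OF sum_abs]) (simp add: abs_mult)
  also have "\<dots> = (\<Sum>j\<in>{-R..R}. \<Sum>i\<in>{-R..R}. \<Sum>k<M. of_bool (X (Suc k) = i) * \<bar>interval_diff (Y k) (Y (Suc k)) j\<bar>)"
    by (rule sum.swap)
  also have "\<dots> = (\<Sum>j\<in>{-R..R}. \<Sum>k<M. \<Sum>i\<in>{-R..R}. of_bool (X (Suc k) = i) * \<bar>interval_diff (Y k) (Y (Suc k)) j\<bar>)"
    by (intro sum.cong refl sum.swap)
  also have "\<dots> = (\<Sum>j\<in>{-R..R}. \<Sum>k<M. \<bar>interval_diff (Y k) (Y (Suc k)) j\<bar>)"
    by (intro sum.cong refl pick boundX)
  also have "\<dots> = (\<Sum>k<M. \<Sum>j\<in>{-R..R}. \<bar>interval_diff (Y k) (Y (Suc k)) j\<bar>)"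
    by (rule sum.swap)
  also have "\<dots> = (\<Sum>k<M. \<bar>Y (Suc k) - Y k\<bar>)"
    by (intro sum.cong refl sum_abs_interval_diff less_imp_le[OF boundY])
  finally show ?thesis using 1 by (simp add: tv_def len_def sum.distrib)
qed

definition near :: "int \<Rightarrow> (int \<times> int) set"
  where "near N = {(i, j). \<exists>k\<le>M. \<bar>i - X k\<bar> \<le> N \<and> \<bar>j - Y k\<bar> \<le> N}"

text \<open>Distinct lattice points are counted, not indices: a step either stays put or costs at
  least one unit of length. This makes the bound independent of the number M of steps, that is, of
  the fineness of the division.\<close>

lemma card_near_le:
  assumes "N \<ge> 0"
  shows "finite (near N)" and "int (card (near N)) \<le> (2 * N + 1)\<^sup>2 * (1 + len)"
proof -
  define P where "P m = (\<lambda>k. (X k, Y k)) ` {..m}" for m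
  define S where "S = {-N..N} \<times> {-N..N}"
  have sub: "near N \<subseteq> (\<lambda>((x, y), (a, b)). (x + a, y + b)) ` (P M \<times> S)"
  proof
    fix z assume "z \<in> near N"
    then obtain i j k where k: "z = (i, j)" "k \<le> M" "\<bar>i - X k\<bar> \<le> N" "\<bar>j - Y k\<bar> \<le> N"
      by (auto simp: near_def)
    then have "((X k, Y k), (i - X k, j - Y k)) \<in> P M \<times> S"
      by (auto simp: P_def S_def)
    then show "z \<in> (\<lambda>((x, y), (a, b)). (x + a, y + b)) ` (P M \<times> S)"
      using k(1) by force
  qed
  have finP: "finite (P m)" for m by (simp add: P_def)
  have finS: "finite S" by (simp add: S_def)
  show "finite (near N)" by (rule finite_subset[OF sub]) (use finP finS in auto)
  have cP: "int (card (P m)) \<le> 1 + (\<Sum>k<m. \<bar>X (Suc k) - X k\<bar> + \<bar>Y (Suc k) - Y k\<bar>)" for m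
  proof (induction m)
    case (Suc m)
    have P: "P (Suc m) = insert (X (Suc m), Y (Suc m)) (P m)"
      by (auto simp: P_def atMost_Suc)
    show ?case
    proof (cases "X (Suc m) = X m \<and> Y (Suc m) = Y m")
      case True
      then have "(X (Suc m), Y (Suc m)) \<in> P m" by (auto simp: P_def)
      then show ?thesis using Suc P by (simp add: insert_absorb)
    next
      case False
      then have "\<bar>X (Suc m) - X m\<bar> + \<bar>Y (Suc m) - Y m\<bar> \<ge> 1" by linarith
      moreover have "card (P (Suc m)) \<le> Suc (card (P m))" unfolding P by (rule card_insert_le_m1) (use finP in auto)
      ultimately show ?thesis using Suc by simp
    qed
  qed (simp add: P_def)
  have "card (near N) \<le> card (P M \<times> S)"
    using finP finS by (intro order_trans[OF card_mono[OF _ sub] card_image_le]) auto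
  then have "int (card (near N)) \<le> int (card (P M)) * int (card S)"
    by (simp add: card_cartesian_product flip: of_nat_mult)
  also have "int (card S) = (2 * N + 1)\<^sup>2"
    using assms by (simp add: S_def card_cartesian_product power2_eq_square)
  also have "int (card (P M)) * (2 * N + 1)\<^sup>2 \<le> (1 + len) * (2 * N + 1)\<^sup>2"
    using cP[of M] by (intro mult_right_mono) (simp_all add: len_def)
  finally show "int (card (near N)) \<le> (2 * N + 1)\<^sup>2 * (1 + len)"
    by (simp add: mult.commute)
qed

end

section \<open>Integrals around grid squares\<close>

abbreviation ind :: "(int \<times> int) set \<Rightarrow> int \<Rightarrow> int \<Rightarrow> int"
  where "ind E i j \<equiv> of_bool ((i, j) \<in> E)"

section \<open>Perimeters of finite sets of squares\<close>

lemma supported_in_ind_iff: "supported_in R (ind E) \<longleftrightarrow> E \<subseteq> {-R<..<R} \<times> {-R<..<R}"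
  by (force simp: supported_in_def)

lemma finite_supported: "supported_in R (ind E) \<Longrightarrow> finite E"
  unfolding supported_in_ind_iff by (erule finite_subset) simp

text \<open>No edge separates a square of \<open>E1\<close> from a square of \<open>E2\<close>, so
  each boundary edge of the union belongs to exactly one of the two sets.\<close>

lemma tv_split:
  assumes "E1 \<inter> E2 = {}"
    and "\<And>i j. (i, j) \<in> E1 \<Longrightarrow> (i, j - 1) \<notin> E2" and "\<And>i j. (i, j) \<in> E2 \<Longrightarrow> (i, j - 1) \<notin> E1"
    and "\<And>i j. (i, j) \<in> E1 \<Longrightarrow> (i - 1, j) \<notin> E2" and "\<And>i j. (i, j) \<in> E2 \<Longrightarrow> (i - 1, j) \<notin> E1"
  shows "tv R (ind (E1 \<union> E2)) = tv R (ind E1) + tv R (ind E2)"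
  unfolding tv_def sum.distrib[symmetric]
proof (intro sum.cong refl)
  fix i j
  have 0: "\<not> ((a, b) \<in> E1 \<and> (a, b) \<in> E2)" for a b using assms(1) by blast
  have "\<bar>ind (E1 \<union> E2) i j - ind (E1 \<union> E2) i (j - 1)\<bar>
      = \<bar>ind E1 i j - ind E1 i (j - 1)\<bar> + \<bar>ind E2 i j - ind E2 i (j - 1)\<bar>"
    using 0[of i j] 0[of i "j - 1"] assms(2)[of i j] assms(3)[of i j]
    by (cases "(i, j) \<in> E1"; cases "(i, j) \<in> E2"; cases "(i, j - 1) \<in> E1"; cases "(i, j - 1) \<in> E2") simp_all
  moreover have "\<bar>ind (E1 \<union> E2) (i - 1) j - ind (E1 \<union> E2) i j\<bar>
      = \<bar>ind E1 (i - 1) j - ind E1 i j\<bar> + \<bar>ind E2 (i - 1) j - ind E2 i j\<bar>"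
    using 0[of i j] 0[of "i - 1" j] assms(4)[of i j] assms(5)[of i j]
    by (cases "(i, j) \<in> E1"; cases "(i, j) \<in> E2"; cases "(i - 1, j) \<in> E1"; cases "(i - 1, j) \<in> E2") simp_all
  ultimately show "\<bar>ind (E1 \<union> E2) i j - ind (E1 \<union> E2) i (j - 1)\<bar> + \<bar>ind (E1 \<union> E2) (i - 1) j - ind (E1 \<union> E2) i j\<bar>
     = \<bar>ind E1 i j - ind E1 i (j - 1)\<bar> + \<bar>ind E1 (i - 1) j - ind E1 i j\<bar>
      + (\<bar>ind E2 i j - ind E2 i (j - 1)\<bar> + \<bar>ind E2 (i - 1) j - ind E2 i j\<bar>)"
    by linarith
qed

text \<open>The lowest square of an occupied column has a boundary edge below it, and the leftmost
  square of an occupied row has one to its left.\<close>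

lemma tv_ge_projections:
  assumes supp: "supported_in R (ind E)"
  shows "int (card (fst ` E)) + int (card (snd ` E)) \<le> tv R (ind E)"
proof -
  have fin: "finite E" by (rule finite_supported[OF supp])
  have box: "i \<in> {-R..R}" "j \<in> {-R..R}" if "(i, j) \<in> E" for i j
    using that supp unfolding supported_in_ind_iff by force+
  have "int (card (fst ` E)) = (\<Sum>i\<in>fst ` E. 1)" by simp
  also have "\<dots> \<le> (\<Sum>i\<in>fst ` E. \<Sum>j\<in>{-R..R}. \<bar>ind E i j - ind E i (j - 1)\<bar>)"
  proof (rule sum_mono)
    fix i assume "i \<in> fst ` E"
    define J where "J = {j. (i, j) \<in> E}"
    have J: "finite J" "J \<noteq> {}"
      using \<open>i \<in> fst ` E\<close> finite_subset[OF _ finite_imageI[OF fin, of snd], of J]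
      by (force simp: J_def)+
    define j where "j = Min J"
    have "j \<in> J" unfolding j_def by (rule Min_in[OF J])
    moreover have "j - 1 \<notin> J" using Min_le[OF J(1), of "j - 1"] unfolding j_def by force
    ultimately have "1 = \<bar>ind E i j - ind E i (j - 1)\<bar>" "j \<in> {-R..R}"
      using box by (auto simp: J_def)
    then show "1 \<le> (\<Sum>j\<in>{-R..R}. \<bar>ind E i j - ind E i (j - 1)\<bar>)"
      by (metis (no_types, lifting) abs_ge_zero finite_atLeastAtMost_int member_le_sum)
  qed
  also have "\<dots> \<le> (\<Sum>i\<in>{-R..R}. \<Sum>j\<in>{-R..R}. \<bar>ind E i j - ind E i (j - 1)\<bar>)"
    using box by (intro sum_mono2) (auto simp: sum_nonneg)
  finally have 1: "int (card (fst ` E)) \<le> (\<Sum>i\<in>{-R..R}. \<Sum>j\<in>{-R..R}. \<bar>ind E i j - ind E i (j - 1)\<bar>)" .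
  have "int (card (snd ` E)) = (\<Sum>j\<in>snd ` E. 1)" by simp
  also have "\<dots> \<le> (\<Sum>j\<in>snd ` E. \<Sum>i\<in>{-R..R}. \<bar>ind E (i - 1) j - ind E i j\<bar>)"
  proof (rule sum_mono)
    fix j assume "j \<in> snd ` E"
    define J where "J = {i. (i, j) \<in> E}"
    have J: "finite J" "J \<noteq> {}"
      using \<open>j \<in> snd ` E\<close> finite_subset[OF _ finite_imageI[OF fin, of fst], of J]
      by (force simp: J_def)+
    define i where "i = Min J"
    have "i \<in> J" unfolding i_def by (rule Min_in[OF J])
    moreover have "i - 1 \<notin> J" using Min_le[OF J(1), of "i - 1"] unfolding i_def by force
    ultimately have "1 = \<bar>ind E (i - 1) j - ind E i j\<bar>" "i \<in> {-R..R}"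
      using box by (auto simp: J_def)
    then show "1 \<le> (\<Sum>i\<in>{-R..R}. \<bar>ind E (i - 1) j - ind E i j\<bar>)"
      by (metis (no_types, lifting) abs_ge_zero finite_atLeastAtMost_int member_le_sum)
  qed
  also have "\<dots> \<le> (\<Sum>j\<in>{-R..R}. \<Sum>i\<in>{-R..R}. \<bar>ind E (i - 1) j - ind E i j\<bar>)"
    using box by (intro sum_mono2) (auto simp: sum_nonneg)
  also have "\<dots> = (\<Sum>i\<in>{-R..R}. \<Sum>j\<in>{-R..R}. \<bar>ind E (i - 1) j - ind E i j\<bar>)"
    by (rule sum.swap)
  finally show ?thesis using 1 by (simp add: tv_def sum.distrib)
qed

section \<open>Edge and cell integrals of a continuous function\<close>

definition gpt :: "real \<Rightarrow> int \<Rightarrow> int \<Rightarrow> complex"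
  where "gpt d i j = Complex (d * i) (d * j)"

definition hedge :: "real \<Rightarrow> (complex \<Rightarrow> complex) \<Rightarrow> int \<Rightarrow> int \<Rightarrow> complex"
  where "hedge d F i j = contour_integral (linepath (gpt d i j) (gpt d (i + 1) j)) F"

definition vedge :: "real \<Rightarrow> (complex \<Rightarrow> complex) \<Rightarrow> int \<Rightarrow> int \<Rightarrow> complex"
  where "vedge d F i j = contour_integral (linepath (gpt d i j) (gpt d i (j + 1))) F"

lemma in_hedge_iff:
  assumes "d > 0"
  shows "z \<in> closed_segment (gpt d i j) (gpt d (i + 1) j)
     \<longleftrightarrow> d * i \<le> Re z \<and> Re z \<le> d * (i + 1) \<and> Im z = d * j"
  using assms
  by (subst closed_segment_same_Im) (auto simp: gpt_def closed_segment_eq_real_ivl distrib_left)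

lemma in_vedge_iff:
  assumes "d > 0"
  shows "z \<in> closed_segment (gpt d i j) (gpt d i (j + 1))
     \<longleftrightarrow> d * j \<le> Im z \<and> Im z \<le> d * (j + 1) \<and> Re z = d * i"
  using assms
  by (subst closed_segment_same_Re) (auto simp: gpt_def closed_segment_eq_real_ivl distrib_left)

lemma gpt_diff: "gpt d i' j' - gpt d i j = Complex (d * (i' - i)) (d * (j' - j))"
  by (simp add: gpt_def complex_eq_iff algebra_simps)

lemma norm_hedge_sub_le:
  assumes "d > 0" and F: "continuous_on UNIV F" and "e \<ge> 0"
    and "\<And>z. d * i \<le> Re z \<Longrightarrow> Re z \<le> d * (i + 1) \<Longrightarrow> Im z = d * j \<Longrightarrow> norm (F z - c) \<le> e"
  shows "norm (hedge d F i j - c * d) \<le> e * d"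
proof -
  let ?l = "linepath (gpt d i j) (gpt d (i + 1) j)"
  have d: "gpt d (i + 1) j - gpt d i j = d"
    by (simp add: gpt_diff complex_eq_iff)
  have "(F has_contour_integral hedge d F i j) ?l"
    unfolding hedge_def
    by (intro has_contour_integral_integral contour_integrable_continuous_linepath
        continuous_on_subset[OF F]) auto
  from has_contour_integral_diff[OF this has_contour_integral_const_linepath[of c]]
  have "((\<lambda>z. F z - c) has_contour_integral (hedge d F i j - c * d)) ?l"
    by (simp only: d)
  from has_contour_integral_bound_linepath[OF this \<open>e \<ge> 0\<close>]
  show ?thesis using assms(1,4) in_hedge_iff[OF assms(1)] by (simp add: d)
qed

lemma norm_vedge_sub_le:
  assumes "d > 0" and F: "continuous_on UNIV F" and "e \<ge> 0"
    and "\<And>z. d * j \<le> Im z \<Longrightarrow> Im z \<le> d * (j + 1) \<Longrightarrow> Re z = d * i \<Longrightarrow> norm (F z - c) \<le> e"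
  shows "norm (vedge d F i j - c * (\<i> * d)) \<le> e * d"
proof -
  let ?l = "linepath (gpt d i j) (gpt d i (j + 1))"
  have d: "gpt d i (j + 1) - gpt d i j = \<i> * d"
    by (simp add: gpt_diff complex_eq_iff)
  have "(F has_contour_integral vedge d F i j) ?l"
    unfolding vedge_def
    by (intro has_contour_integral_integral contour_integrable_continuous_linepath
        continuous_on_subset[OF F]) auto
  from has_contour_integral_diff[OF this has_contour_integral_const_linepath[of c]]
  have "((\<lambda>z. F z - c) has_contour_integral (vedge d F i j - c * (\<i> * d))) ?l"
    by (simp only: d)
  from has_contour_integral_bound_linepath[OF this \<open>e \<ge> 0\<close>]
  show ?thesis using assms(1,4) in_vedge_iff[OF assms(1)] by (simp add: d norm_mult)
qed

abbreviation cellint :: "real \<Rightarrow> (complex \<Rightarrow> complex) \<Rightarrow> int \<Rightarrow> int \<Rightarrow> complex"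
  where "cellint d F \<equiv> cell (hedge d F) (vedge d F)"

text \<open>Constant forms integrate to 0 around every square. With the values \<open>c * d\<close>
  and \<open>c * (\<i> * d)\<close> of the form c dz on edges, this replaces F by F - c in all cell
  sums.\<close>

lemma cell_sub_const:
  "cell H V i j = cell (\<lambda>i j. H i j - c) (\<lambda>i j. V i j - c') i j"
  by (simp add: cell_def)

lemma dist_le_abs_Re_Im: "norm (z - w) \<le> \<bar>Re z - Re w\<bar> + \<bar>Im z - Im w\<bar>"
  using cmod_le[of "z - w"] by simp

lemma norm_cellint_le:
  assumes "d > 0" and F: "continuous_on UNIV F" and "e \<ge> 0"
    and unif: "\<And>a b. norm (a - b) \<le> 2 * d \<Longrightarrow> norm (F a - F b) \<le> e"
  shows "norm (cellint d F i j) \<le> 4 * e * d"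
proof -
  let ?c = "F (gpt d i j)"
  have near: "norm (F z - ?c) \<le> e" if "d * i \<le> Re z" "Re z \<le> d * (i + 1)" "d * j \<le> Im z" "Im z \<le> d * (j + 1)" for z
  proof (rule unif)
    have "\<bar>Re z - d * i\<bar> \<le> d" "\<bar>Im z - d * j\<bar> \<le> d" using that by (simp_all add: algebra_simps abs_le_iff)
    then show "norm (z - gpt d i j) \<le> 2 * d"
      using dist_le_abs_Re_Im[of z "gpt d i j"] by (simp add: gpt_def)
  qed
  have d: "d * i \<le> d * (i + 1)" "d * j \<le> d * (j + 1)" using assms(1) by auto
  have 1: "norm (hedge d F i j - ?c * d) \<le> e * d"
    by (rule norm_hedge_sub_le[OF assms(1) F assms(3)]) (rule near, use d in auto)
  have 2: "norm (hedge d F i (j + 1) - ?c * d) \<le> e * d"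
    by (rule norm_hedge_sub_le[OF assms(1) F assms(3)]) (rule near, use d in auto)
  have 3: "norm (vedge d F i j - ?c * (\<i> * d)) \<le> e * d"
    by (rule norm_vedge_sub_le[OF assms(1) F assms(3)]) (rule near, use d in auto)
  have 4: "norm (vedge d F (i + 1) j - ?c * (\<i> * d)) \<le> e * d"
    by (rule norm_vedge_sub_le[OF assms(1) F assms(3)]) (rule near, use d in auto)
  have "norm (a + b - a' - b') \<le> norm a + norm b + norm a' + norm b'" for a b a' b' :: complex
    by (intro order_trans[OF norm_triangle_ineq4] add_mono norm_triangle_ineq order_refl)
  from order_trans[OF this add_mono[OF add_mono[OF add_mono[OF 1 4] 2] 3]]
  show ?thesis
    unfolding cell_sub_const[of _ _ i j "?c * d" "?c * (\<i> * d)"] cell_def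
    by (simp add: algebra_simps)
qed

text \<open>A set whose two coordinate projections are intervals lies in a box of side lengths at most
  its perimeter, so that \<open>F\<close> oscillates little on its boundary; any other set splits at a gap of
  a projection into two sets without common edges.\<close>

lemma norm_sum_cellint_small_perimeter:
  fixes d e \<eta> :: real
  assumes "d > 0" and F: "continuous_on UNIV F" and "e \<ge> 0"
    and unif: "\<And>a b. norm (a - b) \<le> \<eta> \<Longrightarrow> norm (F a - F b) \<le> e"
    and supp: "supported_in R (ind E)" and "R \<ge> 0"
    and small: "d * tv R (ind E) \<le> \<eta>"
  shows "norm (\<Sum>i\<in>{-R..R}. \<Sum>j\<in>{-R..R}. of_int (ind E i j) * cellint d F i j)
     \<le> e * d * tv R (ind E)"
  using supp small
proof (induction "card E" arbitrary: E rule: less_induct)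
  case less
  note supp = less.prems(1) and small = less.prems(2)
  have fin: "finite E" by (rule finite_supported[OF supp])
  have tv_nonneg: "tv R u \<ge> 0" for u unfolding tv_def by (intro sum_nonneg) simp
  have split: ?case
    if E: "E = E1 \<union> E2" and ne: "E1 \<noteq> {}" "E2 \<noteq> {}" and disj: "E1 \<inter> E2 = {}"
      and tv: "tv R (ind (E1 \<union> E2)) = tv R (ind E1) + tv R (ind E2)" for E1 E2
  proof -
    have fin12: "finite E1" "finite E2" using fin E by auto
    then have "card E = card E1 + card E2" "card E1 > 0" "card E2 > 0"
      using E ne disj by (auto simp: card_Un_disjoint card_gt_0_iff)
    then have c: "card E1 < card E" "card E2 < card E" by auto
    have s: "supported_in R (ind E1)" "supported_in R (ind E2)"
      using supp unfolding E supported_in_ind_iff by auto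
    have "tv R (ind E1) \<le> tv R (ind E)" "tv R (ind E2) \<le> tv R (ind E)"
      using tv tv_nonneg[of "ind E1"] tv_nonneg[of "ind E2"] unfolding E by linarith+
    then have "d * tv R (ind E1) \<le> d * tv R (ind E)" "d * tv R (ind E2) \<le> d * tv R (ind E)"
      using \<open>d > 0\<close> by (simp_all only: mult_le_cancel_left_pos of_int_le_iff)
    then have t: "d * tv R (ind E1) \<le> \<eta>" "d * tv R (ind E2) \<le> \<eta>"
      using small by linarith+
    have "(\<Sum>i\<in>{-R..R}. \<Sum>j\<in>{-R..R}. of_int (ind E i j) * cellint d F i j)
      = (\<Sum>i\<in>{-R..R}. \<Sum>j\<in>{-R..R}. of_int (ind E1 i j) * cellint d F i j)
       + (\<Sum>i\<in>{-R..R}. \<Sum>j\<in>{-R..R}. of_int (ind E2 i j) * cellint d F i j)"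
    proof -
      have "of_int (ind E i j) = (of_int (ind E1 i j) + of_int (ind E2 i j) :: complex)" for i j
        using disj E by auto
      then show ?thesis by (simp only: distrib_right sum.distrib)
    qed
    then have "norm (\<Sum>i\<in>{-R..R}. \<Sum>j\<in>{-R..R}. of_int (ind E i j) * cellint d F i j)
       \<le> e * d * tv R (ind E1) + e * d * tv R (ind E2)"
      by (simp only:) (rule order_trans[OF norm_triangle_ineq
          add_mono[OF less.hyps[OF c(1) s(1) t(1)] less.hyps[OF c(2) s(2) t(2)]]])
    also have "\<dots> = e * d * tv R (ind E)"
      using tv unfolding E by (simp only: of_int_add distrib_left)
    finally show ?thesis .
  qed
  consider "E = {}" | i where "E \<noteq> {}" "Min (fst ` E) < i" "i < Max (fst ` E)" "i \<notin> fst ` E"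
    | j where "E \<noteq> {}" "Min (snd ` E) < j" "j < Max (snd ` E)" "j \<notin> snd ` E"
    | "E \<noteq> {}" "{Min (fst ` E)..Max (fst ` E)} \<subseteq> fst ` E" "{Min (snd ` E)..Max (snd ` E)} \<subseteq> snd ` E"
  proof (cases "E = {}")
    case False
    have m: "Min (fst ` E) \<in> fst ` E" "Max (fst ` E) \<in> fst ` E" "Min (snd ` E) \<in> snd ` E" "Max (snd ` E) \<in> snd ` E"
      using fin False by (intro Min_in Max_in; simp)+
    then have "x \<in> {Min (fst ` E)<..<Max (fst ` E)}" if "x \<in> {Min (fst ` E)..Max (fst ` E)}" "x \<notin> fst ` E" for x
      using that by (cases "x = Min (fst ` E)"; cases "x = Max (fst ` E)") auto
    moreover have "x \<in> {Min (snd ` E)<..<Max (snd ` E)}" if "x \<in> {Min (snd ` E)..Max (snd ` E)}" "x \<notin> snd ` E" for x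
      using that m by (cases "x = Min (snd ` E)"; cases "x = Max (snd ` E)") auto
    ultimately show ?thesis
      using that False by (meson greaterThanLessThan_iff subsetI)
  qed (rule that)
  then show ?case
  proof cases
    case 1
    then show ?thesis by (simp add: tv_def)
  next
    case (2 i)
    have "Min (fst ` E) \<in> fst ` E" "Max (fst ` E) \<in> fst ` E"
      using fin 2(1) by auto
    with 2 have ne: "{z \<in> E. fst z < i} \<noteq> {}" "{z \<in> E. fst z > i} \<noteq> {}" by auto
    have ni: "(i, j) \<notin> E" for j using 2(4) by force
    show ?thesis
    proof (rule split[OF _ ne])
      show "E = {z \<in> E. fst z < i} \<union> {z \<in> E. fst z > i}"
        using ni by (auto simp: not_less_iff_gr_or_eq linorder_neq_iff)
      show "tv R (ind ({z \<in> E. fst z < i} \<union> {z \<in> E. fst z > i}))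
          = tv R (ind {z \<in> E. fst z < i}) + tv R (ind {z \<in> E. fst z > i})"
        by (rule tv_split) auto
    qed auto
  next
    case (3 i)
    have "Min (snd ` E) \<in> snd ` E" "Max (snd ` E) \<in> snd ` E"
      using fin 3(1) by auto
    with 3 have ne: "{z \<in> E. snd z < i} \<noteq> {}" "{z \<in> E. snd z > i} \<noteq> {}" by auto
    have ni: "(j, i) \<notin> E" for j using 3(4) by force
    show ?thesis
    proof (rule split[OF _ ne])
      show "E = {z \<in> E. snd z < i} \<union> {z \<in> E. snd z > i}"
        using ni by (auto simp: not_less_iff_gr_or_eq linorder_neq_iff)
      show "tv R (ind ({z \<in> E. snd z < i} \<union> {z \<in> E. snd z > i}))
          = tv R (ind {z \<in> E. snd z < i}) + tv R (ind {z \<in> E. snd z > i})"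
        by (rule tv_split) auto
    qed auto
  next
    case 4
    define i0 i1 j0 j1 where "i0 = Min (fst ` E)" "i1 = Max (fst ` E)" "j0 = Min (snd ` E)" "j1 = Max (snd ` E)"
    note defs = this
    have in_box: "i0 \<le> i" "i \<le> i1" "j0 \<le> j" "j \<le> j1" if "(i, j) \<in> E" for i j
      using fin that unfolding defs by (force intro!: Min_le Max_ge)+
    have ne: "i0 \<le> i1" "j0 \<le> j1" using in_box 4(1) by fastforce+
    \<comment> \<open>Here the absence of gaps enters: every column and row of the bounding box is
      occupied, so the projections have as many elements as its sides.\<close>
    have "card {i0..i1} \<le> card (fst ` E)" "card {j0..j1} \<le> card (snd ` E)"
      using 4 fin unfolding defs by (intro card_mono; simp)+
    then have tv: "(i1 - i0 + 1) + (j1 - j0 + 1) \<le> tv R (ind E)"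
      using tv_ge_projections[OF supp] ne by simp
    have tv': "d * (i1 + 1) - d * i0 + (d * (j1 + 1) - d * j0) \<le> \<eta>"
    proof -
      have "d * (i1 + 1) - d * i0 + (d * (j1 + 1) - d * j0) = d * of_int ((i1 - i0 + 1) + (j1 - j0 + 1))"
        by (simp add: algebra_simps)
      also have "\<dots> \<le> d * tv R (ind E)"
        using tv \<open>d > 0\<close> by (intro mult_left_mono) (simp_all only: of_int_le_iff)
      finally show ?thesis using small by simp
    qed
    let ?c = "F (gpt d i0 j0)"
    have near: "norm (F z - ?c) \<le> e"
      if "d * i0 \<le> Re z" "Re z \<le> d * (i1 + 1)" "d * j0 \<le> Im z" "Im z \<le> d * (j1 + 1)" for z
    proof (rule unif)
      show "norm (z - gpt d i0 j0) \<le> \<eta>"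
        using dist_le_abs_Re_Im[of z "gpt d i0 j0"] that tv' by (simp add: gpt_def)
    qed
    have mono: "d * real_of_int a \<le> d * of_int b" if "a \<le> b" for a b
      using that \<open>d > 0\<close> by simp
    \<comment> \<open>After subtraction of the form with the constant value of F at the corner of
      the box, every boundary edge of E carries at most \<open>e * d\<close>.\<close>
    have "norm (\<Sum>i\<in>{-R..R}. \<Sum>j\<in>{-R..R}. of_int (ind E i j) *
        cell (\<lambda>i j. hedge d F i j - ?c * d) (\<lambda>i j. vedge d F i j - ?c * (\<i> * d)) i j)
      \<le> e * d * tv R (ind E)"
    proof (rule norm_sum_cell_le[OF supp \<open>R \<ge> 0\<close>])
      fix i j assume "ind E i j \<noteq> ind E i (j - 1)"
      then have "(i, j) \<in> E \<or> (i, j - 1) \<in> E" by (auto split: if_splits)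
      then have b: "i0 \<le> i" "i + 1 \<le> i1 + 1" "j0 \<le> j" "j \<le> j1 + 1" using in_box by force+
      show "norm (hedge d F i j - ?c * d) \<le> e * d"
        by (rule norm_hedge_sub_le[OF assms(1) F assms(3)])
           (rule near; use b[THEN mono] in simp)
    next
      fix i j assume "ind E (i - 1) j \<noteq> ind E i j"
      then have "(i, j) \<in> E \<or> (i - 1, j) \<in> E" by (auto split: if_splits)
      then have b: "i0 \<le> i" "i \<le> i1 + 1" "j0 \<le> j" "j + 1 \<le> j1 + 1" using in_box by force+
      show "norm (vedge d F i j - ?c * (\<i> * d)) \<le> e * d"
        by (rule norm_vedge_sub_le[OF assms(1) F assms(3)])
           (rule near; use b[THEN mono] in simp)
    qed (use assms in auto)
    then show ?thesis
      by (simp only: cell_sub_const[symmetric])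
  qed
qed

text \<open>Meant for sets of large perimeter, whose shape gives no control of F: each square of S
  is charged the oscillation at the scale of the grid on its four edges of length d.\<close>

lemma norm_sum_cellint_near_le:
  fixes d e :: real
  assumes "d > 0" and F: "continuous_on UNIV F" and "e \<ge> 0"
    and unif: "\<And>a b. norm (a - b) \<le> 2 * d \<Longrightarrow> norm (F a - F b) \<le> e"
    and "finite S" and zero: "\<And>i j. (i, j) \<in> E - S \<Longrightarrow> cellint d F i j = 0"
  shows "norm (\<Sum>i\<in>{-R..R}. \<Sum>j\<in>{-R..R}. of_int (ind E i j) * cellint d F i j)
     \<le> card S * (4 * e * d)"
proof -
  let ?B = "{-R..R} \<times> {-R..R}"
  have "norm (of_int (ind E i j) * cellint d F i j) \<le> (if (i, j) \<in> S then 4 * e * d else 0)" for i j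
  proof (cases "(i, j) \<in> E")
    case True
    then show ?thesis
      using norm_cellint_le[OF assms(1-4), of i j] zero[of i j] by auto
  qed (use assms in auto)
  then have "norm (\<Sum>i\<in>{-R..R}. \<Sum>j\<in>{-R..R}. of_int (ind E i j) * cellint d F i j)
    \<le> (\<Sum>i\<in>{-R..R}. \<Sum>j\<in>{-R..R}. if (i, j) \<in> S then 4 * e * d else 0)"
    by (intro sum_norm_le) simp
  also have "\<dots> = (\<Sum>z\<in>?B. if z \<in> S then 4 * e * d else 0)"
    by (simp add: sum.cartesian_product)
  also have "\<dots> = card (?B \<inter> S) * (4 * e * d)"
    by (subst sum.inter_restrict[symmetric]) simp_all
  also have "\<dots> \<le> card S * (4 * e * d)"
    using assms by (intro mult_right_mono) (auto intro: card_mono)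
  finally show ?thesis .
qed

text \<open>Both perimeter regimes are brought into the form of a constant times the perimeter, the
  form that can be summed over all levels; the total perimeter is then at most
  \<open>len\<close>.\<close>

lemma (in lattice_loop) norm_sum_wind_cellint_le:
  fixes d e1 e2 \<eta> :: real
  assumes "d > 0" and F: "continuous_on UNIV F" and "e1 \<ge> 0" and "e2 \<ge> 0" and "\<eta> > 0"
    and unif1: "\<And>a b. norm (a - b) \<le> \<eta> \<Longrightarrow> norm (F a - F b) \<le> e1"
    and unif2: "\<And>a b. norm (a - b) \<le> 2 * d \<Longrightarrow> norm (F a - F b) \<le> e2"
    and "N \<ge> 0"
    and zero: "\<And>i j. (i, j) \<notin> near N \<Longrightarrow> wind i j \<noteq> 0 \<Longrightarrow> cellint d F i j = 0"
  shows "norm (\<Sum>i\<in>{-R..R}. \<Sum>j\<in>{-R..R}. of_int (wind i j) * cellint d F i j)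
     \<le> 2 * (d * len) * (e1 + 4 * e2 * (d * ((2 * N + 1)\<^sup>2 * (1 + len))) / \<eta>)"
proof -
  define \<beta> :: real where "\<beta> = of_int ((2 * N + 1)\<^sup>2 * (1 + len))"
  define c where "c = d * (e1 + 4 * e2 * (d * \<beta>) / \<eta>)"
  have \<beta>: "real (card (near N)) \<le> \<beta>"
    using card_near_le(2)[OF \<open>N \<ge> 0\<close>] unfolding \<beta>_def by (metis of_int_le_iff of_int_of_nat_eq)
  then have "\<beta> \<ge> 0" by (rule order_trans[rotated]) simp
  then have "c \<ge> 0" using assms unfolding c_def by (intro mult_nonneg_nonneg add_nonneg_nonneg divide_nonneg_pos) auto
  have key: "norm (\<Sum>i\<in>{-R..R}. \<Sum>j\<in>{-R..R}. of_int (ind E i j) * cellint d F i j) \<le> c * tv R (ind E)"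
    if E: "\<And>i j. (i, j) \<in> E \<Longrightarrow> wind i j \<noteq> 0" for E
  proof -
    have supp: "supported_in R (ind E)"
      using wind_supported E unfolding supported_in_ind_iff supported_in_def by fastforce
    have tv_nonneg: "0 \<le> real_of_int (tv R (ind E))" unfolding tv_def by (simp add: sum_nonneg)
    show ?thesis
    proof (cases "d * tv R (ind E) \<le> \<eta>")
      case True
      have "norm (\<Sum>i\<in>{-R..R}. \<Sum>j\<in>{-R..R}. of_int (ind E i j) * cellint d F i j) \<le> e1 * d * tv R (ind E)"
        by (rule norm_sum_cellint_small_perimeter[OF \<open>d > 0\<close> F \<open>e1 \<ge> 0\<close> unif1 supp _ True])
           (use R_pos in auto)
      also have "\<dots> \<le> c * tv R (ind E)"
        using tv_nonneg assms \<open>\<beta> \<ge> 0\<close> unfolding c_def by (intro mult_right_mono) (auto simp: algebra_simps)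
      finally show ?thesis .
    next
      case False
      have "norm (\<Sum>i\<in>{-R..R}. \<Sum>j\<in>{-R..R}. of_int (ind E i j) * cellint d F i j)
         \<le> card (near N) * (4 * e2 * d)"
        using zero E
        by (intro norm_sum_cellint_near_le[OF \<open>d > 0\<close> F \<open>e2 \<ge> 0\<close> unif2] card_near_le \<open>N \<ge> 0\<close>) auto
      also have "\<dots> \<le> \<beta> * (4 * e2 * d)"
        using \<beta> assms by (intro mult_right_mono) auto
      \<comment> \<open>For a large perimeter the inserted factor is at least 1. It makes the flat
        bound proportional to the perimeter and thereby takes the place of counting the large
        sets.\<close>
      also have "\<dots> \<le> \<beta> * (4 * e2 * d) * (d * tv R (ind E) / \<eta>)"
        using False assms \<open>\<beta> \<ge> 0\<close>
        by (intro mult_left_mono[of 1 _ "\<beta> * (4 * e2 * d)", simplified mult_1_right]) (auto simp: field_simps)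
      also have "\<dots> \<le> c * tv R (ind E)"
        using tv_nonneg assms unfolding c_def by (simp add: algebra_simps)
      finally show ?thesis .
    qed
  qed
  have "norm (\<Sum>i\<in>{-R..R}. \<Sum>j\<in>{-R..R}. of_int (wind i j) * cellint d F i j) \<le> 2 * c * tv R wind"
  proof (rule norm_sum_cells_signed_le[OF \<open>c \<ge> 0\<close>])
    fix n :: int assume "n \<ge> 1"
    show "norm (\<Sum>i\<in>{-R..R}. \<Sum>j\<in>{-R..R}. of_int (of_bool (n \<le> wind i j)) * cellint d F i j)
        \<le> c * tv R (\<lambda>i j. of_bool (n \<le> wind i j))"
      using key[of "{(i, j). n \<le> wind i j}"] \<open>n \<ge> 1\<close> by fastforce
    show "norm (\<Sum>i\<in>{-R..R}. \<Sum>j\<in>{-R..R}. of_int (of_bool (n \<le> - wind i j)) * cellint d F i j)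
        \<le> c * tv R (\<lambda>i j. of_bool (n \<le> - wind i j))"
      using key[of "{(i, j). n \<le> - wind i j}"] \<open>n \<ge> 1\<close> by fastforce
  qed
  also have "\<dots> \<le> 2 * c * len"
    using tv_wind_le \<open>c \<ge> 0\<close> by (intro mult_left_mono) simp_all
  also have "2 * c * len = 2 * (d * len) * (e1 + 4 * e2 * (d * \<beta>) / \<eta>)"
    by (simp add: c_def)
  finally show ?thesis
    by (simp add: \<beta>_def)
qed

section \<open>Cauchy's theorem and the Cauchy kernel on grid squares\<close>

lemma contour_integral_cell_boundary:
  assumes "d > 0"
    and cont: "continuous_on (path_image (rectpath (gpt d i j) (gpt d (i + 1) (j + 1)))) F"
  shows "contour_integral (rectpath (gpt d i j) (gpt d (i + 1) (j + 1))) F = cellint d F i j"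
proof -
  have a: "Complex (Re (gpt d (i + 1) (j + 1))) (Im (gpt d i j)) = gpt d (i + 1) j"
    "Complex (Re (gpt d i j)) (Im (gpt d (i + 1) (j + 1))) = gpt d i (j + 1)"
    by (simp_all add: gpt_def)
  let ?p1 = "linepath (gpt d i j) (gpt d (i + 1) j)"
  let ?p2 = "linepath (gpt d (i + 1) j) (gpt d (i + 1) (j + 1))"
  let ?p3 = "linepath (gpt d (i + 1) (j + 1)) (gpt d i (j + 1))"
  let ?p4 = "linepath (gpt d i (j + 1)) (gpt d i j)"
  have rp: "rectpath (gpt d i j) (gpt d (i + 1) (j + 1)) = ?p1 +++ ?p2 +++ ?p3 +++ ?p4"
    by (simp add: rectpath_def a Let_def)
  have int: "F contour_integrable_on ?p1" "F contour_integrable_on ?p2"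
    "F contour_integrable_on ?p3" "F contour_integrable_on ?p4"
    using cont unfolding rp
    by (auto intro!: contour_integrable_continuous_linepath elim!: continuous_on_subset simp: path_image_join)
  have "contour_integral (?p1 +++ ?p2 +++ ?p3 +++ ?p4) F
     = contour_integral ?p1 F + (contour_integral ?p2 F + (contour_integral ?p3 F + contour_integral ?p4 F))"
    using int by (simp add: contour_integrable_joinI)
  also have "contour_integral ?p3 F = - hedge d F i (j + 1)"
    unfolding hedge_def using contour_integral_reversepath[of "linepath (gpt d i (j + 1)) (gpt d (i + 1) (j + 1))" F]
    by simp
  also have "contour_integral ?p4 F = - vedge d F i j"
    unfolding vedge_def using contour_integral_reversepath[of "linepath (gpt d i j) (gpt d i (j + 1))" F]
    by simp
  finally show ?thesis by (simp add: rp cell_def hedge_def vedge_def)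
qed

abbreviation gcell :: "real \<Rightarrow> int \<Rightarrow> int \<Rightarrow> complex set"
  where "gcell d i j \<equiv> cbox (gpt d i j) (gpt d (i + 1) (j + 1))"

lemma path_image_cell_boundary:
  assumes "d > 0"
  shows "path_image (rectpath (gpt d i j) (gpt d (i + 1) (j + 1)))
    = gcell d i j - box (gpt d i j) (gpt d (i + 1) (j + 1))"
  using assms by (intro path_image_rectpath_cbox_minus_box) (auto simp: gpt_def)

lemma cellint_eq_0:
  assumes "d > 0" and "F holomorphic_on gcell d i j"
  shows "cellint d F i j = 0"
proof -
  have "(F has_contour_integral 0) (rectpath (gpt d i j) (gpt d (i + 1) (j + 1)))"
    using path_image_cell_boundary[OF \<open>d > 0\<close>]
    by (intro Cauchy_theorem_convex_simple[OF assms(2)]) auto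
  moreover have "continuous_on (path_image (rectpath (gpt d i j) (gpt d (i + 1) (j + 1)))) F"
    using path_image_cell_boundary[OF \<open>d > 0\<close>] holomorphic_on_imp_continuous_on[OF assms(2)]
    by (auto elim: continuous_on_subset)
  ultimately show ?thesis
    using contour_integral_cell_boundary[OF \<open>d > 0\<close>] by (metis contour_integral_unique)
qed

text \<open>The centre of a square lies off all grid edges, so the Cauchy kernel at it is continuous
  along each of them.\<close>

definition gcenter :: "real \<Rightarrow> int \<Rightarrow> int \<Rightarrow> complex"
  where "gcenter d i j = Complex (d * (i + 1/2)) (d * (j + 1/2))"

text \<open>A Kronecker delta up to \<open>2 * pi * \<i>\<close>: in Green's formula this kernel
  reads off the value of \<open>wind\<close> at a single square.\<close>

lemma cellint_inverse_center:
  assumes "d > 0"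
  shows "cellint d (\<lambda>w. 1 / (w - gcenter d a b)) i j = (if i = a \<and> j = b then 2 * pi * \<i> else 0)"
proof (cases "i = a \<and> j = b")
  case True
  let ?r = "rectpath (gpt d i j) (gpt d (i + 1) (j + 1))"
  have c: "gcenter d a b \<in> box (gpt d i j) (gpt d (i + 1) (j + 1))"
    using assms True by (auto simp: in_box_complex_iff gpt_def gcenter_def)
  then have nin: "gcenter d a b \<notin> path_image ?r"
    using path_image_cell_boundary[OF assms] by auto
  have "continuous_on (path_image ?r) (\<lambda>w. 1 / (w - gcenter d a b))"
    using nin by (intro continuous_intros) auto
  from contour_integral_cell_boundary[OF assms this] winding_number_valid_path[OF _ nin] winding_number_rectpath[OF c]
  show ?thesis using True by (simp add: field_simps)
next
  case False
  have "gcenter d a b \<notin> gcell d i j"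
  proof
    assume "gcenter d a b \<in> gcell d i j"
    then have "d * i \<le> d * (a + 1/2)" "d * (a + 1/2) \<le> d * (i + 1)" "d * j \<le> d * (b + 1/2)" "d * (b + 1/2) \<le> d * (j + 1)"
      by (simp_all add: in_cbox_complex_iff gpt_def gcenter_def)
    then have "real_of_int i \<le> a + 1/2" "a + 1/2 \<le> real_of_int i + 1" "real_of_int j \<le> b + 1/2" "b + 1/2 \<le> real_of_int j + 1"
      using assms by (simp_all only: mult_le_cancel_left_pos)
    then have "i = a" "j = b" by linarith+
    then show False using False by simp
  qed
  then have "(\<lambda>w. 1 / (w - gcenter d a b)) holomorphic_on gcell d i j"
    by (intro holomorphic_intros) auto
  then show ?thesis using cellint_eq_0[OF assms] False by auto
qed

section \<open>Rounding a curve to the grid\<close>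

text \<open>The l1 norm, for which the distance of two grid points is exactly d times their lattice
  distance.\<close>

definition norm1 :: "complex \<Rightarrow> real"
  where "norm1 z = \<bar>Re z\<bar> + \<bar>Im z\<bar>"

lemma norm1_nonneg [simp]: "norm1 z \<ge> 0" by (simp add: norm1_def)

lemma norm1_zero [simp]: "norm1 0 = 0" by (simp add: norm1_def)

lemma norm_le_norm1: "norm z \<le> norm1 z" unfolding norm1_def by (rule cmod_le)

lemma norm1_le_norm: "norm1 z \<le> 2 * norm z"
  using abs_Re_le_cmod[of z] abs_Im_le_cmod[of z] by (simp add: norm1_def)

lemma norm1_triangle: "norm1 (a - c) \<le> norm1 (a - b) + norm1 (b - c)"
  by (simp add: norm1_def)

lemma norm1_minus_commute: "norm1 (a - b) = norm1 (b - a)"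
  by (simp add: norm1_def abs_minus_commute)

lemma norm1_gpt_diff: "d > 0 \<Longrightarrow> norm1 (gpt d i' j' - gpt d i j) = d * of_int (\<bar>i' - i\<bar> + \<bar>j' - j\<bar>)"
  by (simp add: norm1_def gpt_diff abs_mult distrib_left)

text \<open>Rounding with hysteresis: the lattice point moves only once the curve has left its
  \<open>3d\<close>-neighbourhood, so that a lattice jump is paid for by a comparable movement of the curve,
  however fine the sequence \<open>p\<close> is. The amortization uses twice the current rounding error as
  potential.\<close>

lemma hysteresis_rounding:
  fixes p :: "nat \<Rightarrow> complex"
  assumes "d > 0" and step: "\<And>k. k < m \<Longrightarrow> norm (p (Suc k) - p k) \<le> d"
    and closed: "p m = p 0"
    and B: "(\<Sum>k<m. norm (p (Suc k) - p k)) \<le> B"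
  obtains X Y :: "nat \<Rightarrow> int"
  where "X (Suc m) = X 0" "Y (Suc m) = Y 0"
    and "\<And>k. k \<le> m \<Longrightarrow> norm1 (p k - gpt d (X k) (Y k)) \<le> 3 * d"
    and "\<And>k. k \<le> m \<Longrightarrow> \<bar>X (Suc k) - X k\<bar> + \<bar>Y (Suc k) - Y k\<bar> \<le> 6"
    and "d * (\<Sum>k<Suc m. \<bar>X (Suc k) - X k\<bar> + \<bar>Y (Suc k) - Y k\<bar>) \<le> 4 * B + 3 * d"
    and "\<And>k. k > m \<Longrightarrow> X k = X 0 \<and> Y k = Y 0"
proof -
  define rnd where "rnd z = (round (Re z / d), round (Im z / d))" for z
  define G where "G q = gpt d (fst q) (snd q)" for q
  have rnd: "norm1 (z - G (rnd z)) \<le> d" for z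
  proof -
    have *: "\<bar>x - d * round (x / d)\<bar> \<le> d / 2" for x
    proof -
      have "x - d * round (x / d) = d * (x / d - round (x / d))"
        using \<open>d > 0\<close> by (simp add: field_simps)
      then have "\<bar>x - d * round (x / d)\<bar> = d * \<bar>of_int (round (x / d)) - x / d\<bar>"
        using \<open>d > 0\<close> by (simp add: abs_mult abs_minus_commute)
      also have "\<dots> \<le> d * (1/2)"
        using \<open>d > 0\<close> by (intro mult_left_mono of_int_round_abs_le) auto
      finally show ?thesis by simp
    qed
    show ?thesis using *[of "Re z"] *[of "Im z"] by (simp add: norm1_def G_def rnd_def gpt_def)
  qed
  define q where "q = rec_nat (rnd (p 0)) (\<lambda>k q. if norm1 (p (Suc k) - G q) \<le> 3 * d then q else rnd (p (Suc k)))"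
  have q0: "q 0 = rnd (p 0)" by (simp add: q_def)
  have qS: "q (Suc k) = (if norm1 (p (Suc k) - G (q k)) \<le> 3 * d then q k else rnd (p (Suc k)))" for k
    by (simp add: q_def)
  have dist: "norm1 (p k - G (q k)) \<le> 3 * d" for k
    using rnd[of "p 0"] rnd[of "p k"] \<open>d > 0\<close> by (cases k) (auto simp: q0 qS)
  define \<Phi> where "\<Phi> k = norm1 (p k - G (q k))" for k
  have moved: "norm1 (G (rnd (p (Suc k))) - G (q k)) \<le> d + norm1 (p (Suc k) - G (q k))" for k
    using norm1_triangle[of "G (rnd (p (Suc k)))" "G (q k)" "p (Suc k)"] rnd[of "p (Suc k)"]
    by (simp add: norm1_minus_commute)
  have tri: "norm1 (p (Suc k) - G (q k)) \<le> norm1 (p (Suc k) - p k) + \<Phi> k" for k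
    unfolding \<Phi>_def by (rule norm1_triangle)
  \<comment> \<open>6 = 1 + 2 + 3: the new rounding error, the l1 length of one step of p, and the
    previous error, each in units of d.\<close>
  have qq: "norm1 (G (q (Suc k)) - G (q k)) \<le> 6 * d" if "k < m" for k
  proof (cases "norm1 (p (Suc k) - G (q k)) \<le> 3 * d")
    case True
    then show ?thesis using \<open>d > 0\<close> by (simp add: qS)
  next
    case False
    then have "q (Suc k) = rnd (p (Suc k))" by (simp add: qS)
    then show ?thesis
      using moved[of k] tri[of k] norm1_le_norm[of "p (Suc k) - p k"] step[OF that] dist[of k]
      unfolding \<Phi>_def by simp
  qed
  have pot1: "norm1 (G (q (Suc k)) - G (q k)) + 2 * \<Phi> (Suc k) \<le> 2 * norm1 (p (Suc k) - p k) + 2 * \<Phi> k" for k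
  proof (cases "norm1 (p (Suc k) - G (q k)) \<le> 3 * d")
    case True
    then have "q (Suc k) = q k" by (simp add: qS)
    then show ?thesis using tri[of k] by (simp add: \<Phi>_def)
  next
    case False
    then have "q (Suc k) = rnd (p (Suc k))" by (simp add: qS)
    \<comment> \<open>If x is the error just before the jump, the jump has length at most x + d and
      leaves an error of at most d. The left side is then at most x + 3 d, and x + 3 d < 2 x since x
      exceeds the threshold 3 d.\<close>
    then show ?thesis
      using moved[of k] tri[of k] rnd[of "p (Suc k)"] False
      unfolding \<Phi>_def by simp
  qed
  have pot: "(\<Sum>k<n. norm1 (G (q (Suc k)) - G (q k))) + 2 * \<Phi> n \<le> 2 * (\<Sum>k<n. norm1 (p (Suc k) - p k)) + 2 * \<Phi> 0" for n
  proof (induction n)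
    case (Suc n)
    then show ?case using pot1[of n] by (simp add: algebra_simps)
  qed simp
  have "(\<Sum>k<m. norm1 (p (Suc k) - p k)) \<le> (\<Sum>k<m. 2 * norm (p (Suc k) - p k))"
    by (intro sum_mono norm1_le_norm)
  also have "\<dots> \<le> 2 * B" using B by (simp add: sum_distrib_left[symmetric])
  finally have pB: "(\<Sum>k<m. norm1 (p (Suc k) - p k)) \<le> 2 * B" .
  have \<Phi>0: "\<Phi> 0 \<le> d" using rnd[of "p 0"] by (simp add: \<Phi>_def q0)
  have last: "norm1 (G (q 0) - G (q m)) \<le> \<Phi> m + \<Phi> 0"
    using norm1_triangle[of "G (q 0)" "G (q m)" "p 0"] closed
    by (simp add: \<Phi>_def norm1_minus_commute)
  \<comment> \<open>Hysteresis depends on the past, so \<open>q m\<close> may differ from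
    \<open>q 0\<close> although \<open>p m = p 0\<close>; one extra step closes the lattice
    path.\<close>
  define q' where "q' k = (if k \<le> m then q k else q 0)" for k
  have q'_last: "norm1 (G (q' (Suc m)) - G (q' m)) \<le> \<Phi> m + \<Phi> 0" using last by (simp add: q'_def)
  have q'_step: "norm1 (G (q' (Suc k)) - G (q' k)) = norm1 (G (q (Suc k)) - G (q k))" if "k < m" for k
    using that by (simp add: q'_def)
  have total: "(\<Sum>k<Suc m. norm1 (G (q' (Suc k)) - G (q' k))) \<le> 4 * B + 3 * d"
  proof -
    have "(\<Sum>k<Suc m. norm1 (G (q' (Suc k)) - G (q' k)))
       = (\<Sum>k<m. norm1 (G (q (Suc k)) - G (q k))) + norm1 (G (q' (Suc m)) - G (q' m))"
      using q'_step by simp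
    moreover have "\<Phi> m \<ge> 0" by (simp add: \<Phi>_def)
    \<comment> \<open>The closing step costs \<open>\<Phi> m + \<Phi> 0\<close>; the first term is
      paid by the potential \<open>2 * \<Phi> m\<close> left at the end, and altogether
      \<open>3 * \<Phi> 0\<close> remains.\<close>
    ultimately show ?thesis using pot[of m] pB \<Phi>0 q'_last by linarith
  qed
  have six: "norm1 (G (q' (Suc k)) - G (q' k)) \<le> 6 * d" if "k \<le> m" for k
    using that q'_step qq q'_last \<Phi>0 dist[of m] \<open>d > 0\<close>
    by (cases "k < m") (auto simp: \<Phi>_def not_less)
  have Gd: "norm1 (G (q' (Suc k)) - G (q' k))
      = d * of_int (\<bar>fst (q' (Suc k)) - fst (q' k)\<bar> + \<bar>snd (q' (Suc k)) - snd (q' k)\<bar>)" for k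
    unfolding G_def by (rule norm1_gpt_diff[OF \<open>d > 0\<close>])
  show thesis
  proof (rule that[of "fst \<circ> q'" "snd \<circ> q'"])
    fix k assume "k \<le> m"
    show "\<bar>(fst \<circ> q') (Suc k) - (fst \<circ> q') k\<bar> + \<bar>(snd \<circ> q') (Suc k) - (snd \<circ> q') k\<bar> \<le> 6"
    proof -
      have "d * real_of_int (\<bar>fst (q' (Suc k)) - fst (q' k)\<bar> + \<bar>snd (q' (Suc k)) - snd (q' k)\<bar>) \<le> d * 6"
        using six[OF \<open>k \<le> m\<close>] Gd by (simp only: mult.commute)
      then have "real_of_int (\<bar>fst (q' (Suc k)) - fst (q' k)\<bar> + \<bar>snd (q' (Suc k)) - snd (q' k)\<bar>) \<le> 6"
        using \<open>d > 0\<close> by (simp only: mult_le_cancel_left_pos)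
      then show ?thesis by simp
    qed
    show "norm1 (p k - gpt d ((fst \<circ> q') k) ((snd \<circ> q') k)) \<le> 3 * d"
      using dist[of k] \<open>k \<le> m\<close> by (simp add: q'_def G_def)
  next
    show "d * of_int (\<Sum>k<Suc m. \<bar>(fst \<circ> q') (Suc k) - (fst \<circ> q') k\<bar> + \<bar>(snd \<circ> q') (Suc k) - (snd \<circ> q') k\<bar>)
        \<le> 4 * B + 3 * d"
      using total unfolding Gd by (simp only: sum_distrib_left[symmetric] of_int_sum[symmetric] o_apply)
  qed (auto simp: q'_def)
qed

section \<open>Logarithm increments between nearby points\<close>

text \<open>The quotient lies in the open unit disc about 1, hence away from the branch cut of
  \<open>Ln\<close>.\<close>

lemma Re_quotient_pos:
  assumes "norm (b - a) < norm (a - z)"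
  shows "Re ((b - z) / (a - z)) > 0"
proof -
  have "a \<noteq> z" using assms by auto
  then have "(b - z) / (a - z) = 1 + (b - a) / (a - z)" by (simp add: field_simps)
  moreover have "norm ((b - a) / (a - z)) < 1" using assms \<open>a \<noteq> z\<close> by (simp add: norm_divide)
  ultimately show ?thesis using abs_Re_le_cmod[of "(b - a) / (a - z)"] by simp
qed

lemma Ln_quotient:
  assumes "norm (b - a) < norm (a - z)"
  shows "exp (Ln ((b - z) / (a - z))) = (b - z) / (a - z)" and "\<bar>Im (Ln ((b - z) / (a - z)))\<bar> < pi / 2"
proof -
  have "(b - z) / (a - z) \<noteq> 0" using Re_quotient_pos[OF assms] by (metis less_irrefl zero_complex.simps(1))
  then show "exp (Ln ((b - z) / (a - z))) = (b - z) / (a - z)" "\<bar>Im (Ln ((b - z) / (a - z)))\<bar> < pi / 2"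
    using Re_quotient_pos[OF assms] Re_Ln_pos_lt by simp_all
qed

text \<open>Both sides have the same exponential. The four imaginary parts are below pi / 2 in
  modulus, so the difference is too small for a nonzero multiple of 2 pi i. This transports
  increments from points of the curve to their rounded neighbours.\<close>

lemma Ln_quotient_add:
  assumes "norm (a' - a) < norm (a - z)" and "norm (b - a) < norm (a - z)"
    and "norm (b' - a') < norm (a' - z)" and "norm (b' - b) < norm (b - z)"
  shows "Ln ((b' - z) / (b - z)) = Ln ((a' - z) / (a - z)) + (Ln ((b' - z) / (a' - z)) - Ln ((b - z) / (a - z)))"
proof (rule exp_complex_eqI)
  note L = Ln_quotient[OF assms(1)] Ln_quotient[OF assms(2)] Ln_quotient[OF assms(3)] Ln_quotient[OF assms(4)]
  have ne: "a \<noteq> z" "a' \<noteq> z" "b \<noteq> z" using assms by auto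
  show "exp (Ln ((b' - z) / (b - z)))
      = exp (Ln ((a' - z) / (a - z)) + (Ln ((b' - z) / (a' - z)) - Ln ((b - z) / (a - z))))"
    using L ne by (simp add: exp_add exp_diff)
  show "\<bar>Im (Ln ((b' - z) / (b - z)))
      - Im (Ln ((a' - z) / (a - z)) + (Ln ((b' - z) / (a' - z)) - Ln ((b - z) / (a - z))))\<bar> < 2 * pi"
    using L unfolding minus_complex.simps plus_complex.simps by linarith
qed

text \<open>A continuous branch could leave the principal one only by passing an imaginary part of
  modulus pi / 2; there the quotient would have real part 0, but it stays in the right
  half-plane.\<close>

lemma continuous_log_increment:
  fixes s t :: real and q g :: "real \<Rightarrow> complex"
  assumes "s \<le> t" and cont: "continuous_on {s..t} q" and g: "\<And>\<tau>. \<tau> \<in> {s..t} \<Longrightarrow> g \<tau> = z + exp (q \<tau>)"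
    and near: "\<And>\<tau>. \<tau> \<in> {s..t} \<Longrightarrow> norm (g \<tau> - g s) < norm (g s - z)"
  shows "q t - q s = Ln ((g t - z) / (g s - z))"
proof -
  have quot: "(g \<tau> - z) / (g s - z) = exp (q \<tau> - q s)" if "\<tau> \<in> {s..t}" for \<tau>
  proof -
    have "g s = z + exp (q s)" by (rule g) (use \<open>s \<le> t\<close> in simp)
    then show ?thesis using g[OF that] by (simp add: exp_diff)
  qed
  have "\<bar>Im (q t - q s)\<bar> < pi / 2"
  proof (rule ccontr)
    have c: "continuous_on {s..t} (\<lambda>\<tau>. \<bar>Im (q \<tau> - q s)\<bar>)"
      by (intro continuous_intros cont)
    assume "\<not> \<bar>Im (q t - q s)\<bar> < pi / 2"
    then obtain \<tau> where \<tau>: "s \<le> \<tau>" "\<tau> \<le> t" "\<bar>Im (q \<tau> - q s)\<bar> = pi / 2"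
      using IVT'[of "\<lambda>\<tau>. \<bar>Im (q \<tau> - q s)\<bar>" s "pi / 2" t] \<open>s \<le> t\<close> c by auto
    have "Re (exp (q \<tau> - q s)) = exp (Re (q \<tau> - q s)) * cos \<bar>Im (q \<tau> - q s)\<bar>"
      by (simp only: Re_exp cos_abs_real)
    also have "\<dots> = 0" unfolding \<tau>(3) by simp
    finally show False
      using Re_quotient_pos[OF near[of \<tau>]] quot[of \<tau>] \<tau> by simp
  qed
  then have "Ln (exp (q t - q s)) = q t - q s"
    using pi_gt_zero by (intro Ln_exp) linarith+
  then show ?thesis using quot[of t] \<open>s \<le> t\<close> by simp
qed

lemma has_field_derivative_Ln_quotient:
  assumes "w \<in> ball q (norm (q - z))"
  shows "((\<lambda>w. Ln ((w - z) / (q - z))) has_field_derivative 1 / (w - z)) (at w)"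
proof -
  have w: "norm (w - q) < norm (q - z)" using assms by (simp add: dist_norm norm_minus_commute)
  have "(w - z) / (q - z) \<notin> \<real>\<^sub>\<le>\<^sub>0"
    using Re_quotient_pos[OF w] by (auto simp: complex_nonpos_Reals_iff)
  moreover have "q \<noteq> z" "w \<noteq> z" using w by (auto simp: norm_minus_commute)
  ultimately show ?thesis
    by (auto intro!: derivative_eq_intros simp: divide_simps)
qed

lemma contour_integral_linepath_inverse:
  assumes "a \<in> ball q (norm (q - z))" and "b \<in> ball q (norm (q - z))"
  shows "contour_integral (linepath a b) (\<lambda>w. 1 / (w - z)) = Ln ((b - z) / (q - z)) - Ln ((a - z) / (q - z))"
proof -
  have "((\<lambda>w. 1 / (w - z)) has_contour_integral
      (Ln ((pathfinish (linepath a b) - z) / (q - z)) - Ln ((pathstart (linepath a b) - z) / (q - z)))) (linepath a b)"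
  proof (rule contour_integral_primitive[where S = "ball q (norm (q - z))"])
    show "path_image (linepath a b) \<subseteq> ball q (norm (q - z))"
      unfolding path_image_linepath by (intro closed_segment_subset assms convex_ball)
  qed (simp_all only: valid_path_linepath has_field_derivative_at_within has_field_derivative_Ln_quotient)
  then show ?thesis by (simp add: contour_integral_unique)
qed

text \<open>All edges of the L-shaped step lie in a disc about its start that avoids z. One branch
  of the logarithm is a primitive of the kernel there, so both legs telescope.\<close>

lemma sum_edges_inverse:
  assumes "d > 0" and bounds: "\<bar>x\<bar> \<le> R" "\<bar>x'\<bar> \<le> R" "\<bar>y\<bar> \<le> R" "\<bar>y'\<bar> \<le> R"
    and near: "d * of_int (\<bar>x' - x\<bar> + \<bar>y' - y\<bar>) < norm (gpt d x y - z)"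
  shows "(\<Sum>i\<in>{-R..R}. of_int (interval_diff x x' i) * hedge d (\<lambda>w. 1 / (w - z)) i y)
    + (\<Sum>j\<in>{-R..R}. of_int (interval_diff y y' j) * vedge d (\<lambda>w. 1 / (w - z)) x' j)
    = Ln ((gpt d x' y' - z) / (gpt d x y - z))"
proof -
  let ?q = "gpt d x y"
  let ?L = "\<lambda>w. Ln ((w - z) / (?q - z))"
  have inb: "gpt d i j \<in> ball ?q (norm (?q - z))" if "\<bar>i - x\<bar> + \<bar>j - y\<bar> \<le> \<bar>x' - x\<bar> + \<bar>y' - y\<bar>" for i j
  proof -
    have "norm (gpt d i j - ?q) \<le> d * of_int (\<bar>i - x\<bar> + \<bar>j - y\<bar>)"
      using norm_le_norm1 norm1_gpt_diff[OF \<open>d > 0\<close>] by metis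
    also have "\<dots> \<le> d * of_int (\<bar>x' - x\<bar> + \<bar>y' - y\<bar>)"
      using that \<open>d > 0\<close> by (simp only: mult_le_cancel_left_pos of_int_le_iff)
    finally show ?thesis using near by (simp add: dist_norm norm_minus_commute)
  qed
  have "(\<Sum>i\<in>{-R..R}. of_int (interval_diff x x' i) * hedge d (\<lambda>w. 1 / (w - z)) i y)
     = (\<Sum>i\<in>{-R..R}. of_int (interval_diff x x' i) * (?L (gpt d (i + 1) y) - ?L (gpt d i y)))"
  proof (intro sum.cong refl)
    fix i
    show "of_int (interval_diff x x' i) * hedge d (\<lambda>w. 1 / (w - z)) i y
       = of_int (interval_diff x x' i) * (?L (gpt d (i + 1) y) - ?L (gpt d i y))"
    proof (cases "interval_diff x x' i = 0")
      case False
      then have "hedge d (\<lambda>w. 1 / (w - z)) i y = ?L (gpt d (i + 1) y) - ?L (gpt d i y)"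
        unfolding hedge_def using interval_diff_nonzeroD[OF False]
        by (intro contour_integral_linepath_inverse inb) linarith+
      then show ?thesis by simp
    qed simp
  qed
  also have "\<dots> = ?L (gpt d x' y) - ?L (gpt d x y)"
    by (rule sum_interval_diff_telescope) (use bounds in auto)
  finally have 1: "(\<Sum>i\<in>{-R..R}. of_int (interval_diff x x' i) * hedge d (\<lambda>w. 1 / (w - z)) i y)
     = ?L (gpt d x' y) - ?L (gpt d x y)" .
  have "(\<Sum>j\<in>{-R..R}. of_int (interval_diff y y' j) * vedge d (\<lambda>w. 1 / (w - z)) x' j)
     = (\<Sum>j\<in>{-R..R}. of_int (interval_diff y y' j) * (?L (gpt d x' (j + 1)) - ?L (gpt d x' j)))"
  proof (intro sum.cong refl)
    fix j
    show "of_int (interval_diff y y' j) * vedge d (\<lambda>w. 1 / (w - z)) x' j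
       = of_int (interval_diff y y' j) * (?L (gpt d x' (j + 1)) - ?L (gpt d x' j))"
    proof (cases "interval_diff y y' j = 0")
      case False
      then have "vedge d (\<lambda>w. 1 / (w - z)) x' j = ?L (gpt d x' (j + 1)) - ?L (gpt d x' j)"
        unfolding vedge_def using interval_diff_nonzeroD[OF False]
        by (intro contour_integral_linepath_inverse inb) linarith+
      then show ?thesis by simp
    qed simp
  qed
  also have "\<dots> = ?L (gpt d x' y') - ?L (gpt d x' y)"
    by (rule sum_interval_diff_telescope) (use bounds in auto)
  finally have 2: "(\<Sum>j\<in>{-R..R}. of_int (interval_diff y y' j) * vedge d (\<lambda>w. 1 / (w - z)) x' j)
     = ?L (gpt d x' y') - ?L (gpt d x' y)" .
  have "?q \<noteq> z" using near \<open>d > 0\<close> by (auto simp: mult_less_0_iff)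
  then show ?thesis unfolding 1 2 by simp
qed

context lattice_loop
begin

text \<open>Some coordinate has an index gap of at least N + 1; the width of the square uses up at
  most one unit of it.\<close>

lemma gcell_far:
  assumes "d > 0" and "(a, b) \<notin> near N" and "z \<in> gcell d a b" and "k \<le> M"
  shows "norm (z - gpt d (X k) (Y k)) \<ge> d * N"
proof -
  have far: "d * of_int N \<le> \<bar>t - d * of_int x\<bar>"
    if "d * of_int i \<le> t" "t \<le> d * of_int (i + 1)" "\<bar>i - x\<bar> > N" for t :: real and i x
  proof (cases "i > x")
    case True
    then have "N + x \<le> i" using that by linarith
    then have "d * of_int (N + x) \<le> d * of_int i"
      using \<open>d > 0\<close> by (simp only: mult_le_cancel_left_pos of_int_le_iff)
    then show ?thesis using that by (simp add: distrib_left)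
  next
    case False
    then have "i + 1 \<le> x - N" using that by linarith
    then have "d * of_int (i + 1) \<le> d * of_int (x - N)"
      using \<open>d > 0\<close> by (simp only: mult_le_cancel_left_pos of_int_le_iff)
    then show ?thesis using that by (simp add: right_diff_distrib)
  qed
  have "\<bar>a - X k\<bar> > N \<or> \<bar>b - Y k\<bar> > N"
    using assms(2,4) unfolding near_def mem_Collect_eq case_prod_conv by (meson not_le)
  moreover have "d * a \<le> Re z" "Re z \<le> d * of_int (a + 1)" "d * b \<le> Im z" "Im z \<le> d * of_int (b + 1)"
    using assms(3) by (auto simp: in_cbox_complex_iff gpt_def)
  ultimately have "d * N \<le> \<bar>Re (z - gpt d (X k) (Y k))\<bar> \<or> d * N \<le> \<bar>Im (z - gpt d (X k) (Y k))\<bar>"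
    using far by (auto simp: gpt_def)
  then show ?thesis
    using abs_Re_le_cmod[of "z - gpt d (X k) (Y k)"] abs_Im_le_cmod[of "z - gpt d (X k) (Y k)"] by linarith
qed

text \<open>The logarithm increments along the rounded path sum to \<open>2 * pi * \<i>\<close>
  times \<open>wind\<close>, by Green's formula for the Cauchy kernel; those along the curve give
  the winding number. The value 20 leaves room: samples of the curve stay 17 d away from the square,
  more than the oscillation d, the rounding error 3 d and the lattice step 6 d.\<close>

lemma wind_eq_winding_number:
  assumes "d > 0" and "path g" and "s 0 = 0" and "s M = 1" and mono: "\<And>k. k < M \<Longrightarrow> s k \<le> s (Suc k)"
    and loop: "g 1 = g 0"
    and osc: "\<And>k \<tau>. k < M \<Longrightarrow> \<tau> \<in> {s k..s (Suc k)} \<Longrightarrow> norm (g \<tau> - g (s k)) \<le> d"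
    and dist: "\<And>k. k \<le> M \<Longrightarrow> norm1 (g (s k) - gpt d (X k) (Y k)) \<le> 3 * d"
    and step: "\<And>k. k < M \<Longrightarrow> \<bar>X (Suc k) - X k\<bar> + \<bar>Y (Suc k) - Y k\<bar> \<le> 6"
    and far: "(a, b) \<notin> near 20" and nz: "wind a b \<noteq> 0"
  shows "gcell d a b \<inter> path_image g = {}" and "winding_number g (gcenter d a b) = wind a b"
proof -
  let ?q = "\<lambda>k. gpt d (X k) (Y k)"
  have q_far: "norm (?q k - z) \<ge> 20 * d" if "k \<le> M" "z \<in> gcell d a b" for k z
    using gcell_far[OF \<open>d > 0\<close> far that(2,1)] by (simp add: norm_minus_commute mult.commute)
  have pq: "norm (g (s k) - ?q k) \<le> 3 * d" if "k \<le> M" for k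
    using dist[OF that] norm_le_norm1 order_trans by blast
  have p_far: "norm (g (s k) - z) \<ge> 17 * d" if "k \<le> M" "z \<in> gcell d a b" for k z
    using q_far[OF that] pq[OF that(1)] norm_triangle_sub[of "?q k - z" "g (s k) - z"]
    by (simp add: norm_minus_commute)
  have s_le: "s k \<le> s l" if "k \<le> l" "l \<le> M" for k l
    using that
  proof (induction l rule: dec_induct)
    case (step l)
    then show ?case using mono[of l] by simp
  qed simp
  have s01: "s k \<in> {0..1}" if "k \<le> M" for k
    using s_le[of 0 k] s_le[of k M] that assms(3,4) by auto
  have cover: "\<exists>k<M. \<tau> \<in> {s k..s (Suc k)}" if "\<tau> \<in> {0..1}" for \<tau>
  proof -
    have "\<exists>k<n. \<tau> \<in> {s k..s (Suc k)}" if "0 < n" "s 0 \<le> \<tau>" "\<tau> \<le> s n" for n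
      using that
    proof (induction n)
      case (Suc n)
      show ?case
      proof (cases "\<tau> \<le> s n \<and> n > 0")
        case True
        then show ?thesis using Suc by (meson less_SucI)
      next
        case False
        then show ?thesis using Suc.prems by (intro exI[of _ n]) auto
      qed
    qed simp
    moreover have "M > 0" using assms(3,4) by (cases M) auto
    ultimately show ?thesis using \<open>\<tau> \<in> {0..1}\<close> assms(3,4) by auto
  qed
  have disj: "g \<tau> \<notin> gcell d a b" if \<tau>: "\<tau> \<in> {0..1}" for \<tau>
  proof
    assume z: "g \<tau> \<in> gcell d a b"
    obtain k where k: "k < M" "\<tau> \<in> {s k..s (Suc k)}" using cover[OF \<tau>] by auto
    show False using osc[OF k] p_far[OF _ z, of k] k \<open>d > 0\<close> by (simp add: norm_minus_commute)
  qed
  then show "gcell d a b \<inter> path_image g = {}" by (auto simp: path_image_def)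
  let ?z = "gcenter d a b"
  have zc: "?z \<in> gcell d a b"
    using \<open>d > 0\<close> by (auto simp: in_cbox_complex_iff gpt_def gcenter_def)
  then have "?z \<notin> path_image g" using disj by (auto simp: path_image_def)
  then obtain lg where lg: "path lg" "pathfinish lg - pathstart lg = 2 * of_real pi * \<i> * winding_number g ?z"
      "\<And>t. t \<in> {0..1} \<Longrightarrow> g t = ?z + exp (lg t)"
    using winding_number_as_continuous_log[OF \<open>path g\<close>] by metis
  \<comment> \<open>The principal logarithm depends on the two points alone, so \<beta> returns to
    its initial value after one turn and its increments cancel.\<close>
  define \<beta> where "\<beta> k = Ln ((?q k - ?z) / (g (s k) - ?z))" for k
  have inc: "Ln ((?q (Suc k) - ?z) / (?q k - ?z)) = (lg (s (Suc k)) - lg (s k)) + (\<beta> (Suc k) - \<beta> k)" if "k < M" for k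
  proof -
    have sub: "{s k..s (Suc k)} \<subseteq> {0..1}" using s01[of k] s01[of "Suc k"] that by auto
    have "lg (s (Suc k)) - lg (s k) = Ln ((g (s (Suc k)) - ?z) / (g (s k) - ?z))"
    proof (rule continuous_log_increment)
      show "continuous_on {s k..s (Suc k)} lg"
        using lg(1) sub by (auto simp: path_def elim: continuous_on_subset)
      show "norm (g \<tau> - g (s k)) < norm (g (s k) - ?z)" if "\<tau> \<in> {s k..s (Suc k)}" for \<tau>
        using osc[OF \<open>k < M\<close> that] p_far[OF _ zc, of k] \<open>k < M\<close> \<open>d > 0\<close> by simp
    qed (use mono that sub lg(3) in auto)
    moreover have "norm (?q (Suc k) - ?q k) \<le> 6 * d"
    proof -
      have "norm (?q (Suc k) - ?q k) \<le> d * of_int (\<bar>X (Suc k) - X k\<bar> + \<bar>Y (Suc k) - Y k\<bar>)"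
        using norm_le_norm1 norm1_gpt_diff[OF \<open>d > 0\<close>] by metis
      also have "\<dots> \<le> d * of_int 6"
        using step[OF that] \<open>d > 0\<close> by (simp only: mult_le_cancel_left_pos of_int_le_iff)
      finally show ?thesis by simp
    qed
    then have "Ln ((?q (Suc k) - ?z) / (?q k - ?z))
       = Ln ((g (s (Suc k)) - ?z) / (g (s k) - ?z)) + (\<beta> (Suc k) - \<beta> k)"
      unfolding \<beta>_def
      using osc[OF that, of "s (Suc k)"] mono[OF that] p_far[OF _ zc, of k] p_far[OF _ zc, of "Suc k"]
        q_far[OF _ zc, of k] pq[of k] pq[of "Suc k"] that \<open>d > 0\<close>
      by (intro Ln_quotient_add) (auto simp: norm_minus_commute)
    ultimately show ?thesis by simp
  qed
  have "(\<Sum>k<M. Ln ((?q (Suc k) - ?z) / (?q k - ?z)))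
      = (\<Sum>k<M. lg (s (Suc k)) - lg (s k)) + (\<Sum>k<M. \<beta> (Suc k) - \<beta> k)"
    using inc by (simp add: sum.distrib)
  also have "(\<Sum>k<M. lg (s (Suc k)) - lg (s k)) = lg 1 - lg 0"
    using assms(3,4) by (simp add: sum_lessThan_telescope[of "\<lambda>k. lg (s k)"])
  also have "(\<Sum>k<M. \<beta> (Suc k) - \<beta> k) = 0"
  proof -
    have "\<beta> M = \<beta> 0" using assms(3,4) loop closedX closedY by (simp add: \<beta>_def)
    then show ?thesis by (simp add: sum_lessThan_telescope[of \<beta>])
  qed
  finally have 1: "(\<Sum>k<M. Ln ((?q (Suc k) - ?z) / (?q k - ?z))) = 2 * pi * \<i> * winding_number g ?z"
    using lg(2) by (simp add: pathfinish_def pathstart_def)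
  have 2: "(\<Sum>k<M. Ln ((?q (Suc k) - ?z) / (?q k - ?z)))
     = (\<Sum>i\<in>{-R..R}. \<Sum>j\<in>{-R..R}. of_int (wind i j) * cellint d (\<lambda>w. 1 / (w - ?z)) i j)"
    unfolding sum_wind_cell
  proof (intro sum.cong refl, rule sum_edges_inverse[symmetric])
    fix k assume "k \<in> {..<M}"
    then have k: "k < M" by simp
    have "d * of_int (\<bar>X (Suc k) - X k\<bar> + \<bar>Y (Suc k) - Y k\<bar>) \<le> d * of_int 6"
      using step[OF k] \<open>d > 0\<close> by (simp only: mult_le_cancel_left_pos of_int_le_iff)
    also have "\<dots> < norm (?q k - ?z)"
      using q_far[OF _ zc, of k] k \<open>d > 0\<close> by simp
    finally show "d * of_int (\<bar>X (Suc k) - X k\<bar> + \<bar>Y (Suc k) - Y k\<bar>) < norm (?q k - ?z)" .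
  qed (use \<open>d > 0\<close> boundX boundY less_imp_le in auto)
  have ab: "a \<in> {-R..R}" "b \<in> {-R..R}"
    using wind_supported nz unfolding supported_in_def by force+
  have "(\<Sum>i\<in>{-R..R}. \<Sum>j\<in>{-R..R}. of_int (wind i j) * cellint d (\<lambda>w. 1 / (w - ?z)) i j)
     = (\<Sum>i\<in>{-R..R}. \<Sum>j\<in>{-R..R}. if i = a then if j = b then of_int (wind a b) * (2 * pi * \<i>) else 0 else 0)"
    unfolding cellint_inverse_center[OF \<open>d > 0\<close>] by (intro sum.cong refl) auto
  also have "\<dots> = (\<Sum>i\<in>{-R..R}. if i = a then of_int (wind a b) * (2 * pi * \<i>) else 0)"
    using ab by (intro sum.cong refl) auto
  also have "\<dots> = of_int (wind a b) * (2 * pi * \<i>)"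
    using ab by simp
  finally show "winding_number g ?z = wind a b" using 1 2 by simp
qed

end

section \<open>Riemann--Stieltjes sums and the index\<close>

text \<open>A tagged division is an unordered set, possibly with one-point members. The induction
  removes the member ending at b and restricts the others to what lies to its left.\<close>

lemma tagged_division_nondegenerate_sorted:
  fixes a b :: real
  assumes "p tagged_division_of {a..b}" and "a \<le> b"
  shows "\<exists>m s x. s 0 = a \<and> s m = b \<and> (\<forall>k<m. s k < s (Suc k)) \<and>
    (\<lambda>k. (x k, {s k..s (Suc k)})) ` {..<m} = {(x, K) \<in> p. Inf K < Sup K}"
  using assms
proof (induction "card p" arbitrary: p b rule: less_induct)
  case less
  note p = less.prems(1)
  have fin: "finite p" by (rule tagged_division_of_finite[OF p])
  have ivl: "\<exists>l r. K = {l..r} \<and> l \<le> r \<and> a \<le> l \<and> r \<le> b \<and> Inf K = l \<and> Sup K = r \<and> x \<in> K"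
    if K: "(x, K) \<in> p" for x K
  proof -
    obtain l r where lr: "K = {l..r}" using tagged_division_ofD(4)[OF p K] by auto
    moreover have "x \<in> K" "K \<subseteq> {a..b}" using tagged_division_ofD(2,3)[OF p K] .
    ultimately have "l \<le> r" by auto
    with lr \<open>x \<in> K\<close> \<open>K \<subseteq> {a..b}\<close> show ?thesis by auto
  qed
  show ?case
  proof (cases "a = b")
    case True
    have "{(x, K) \<in> p. Inf K < Sup K} = {}"
      using ivl True by fastforce
    then show ?thesis using True by (intro exI[of _ 0] exI[of _ "\<lambda>_. a"]) simp
  next
    case False
    then have "a < b" using less.prems(2) by simp
    define S where "S = {t \<in> insert a ((\<lambda>(x, K). Inf K) ` p \<union> (\<lambda>(x, K). Sup K) ` p). t < b}"
    have "finite S" "a \<in> S" using fin \<open>a < b\<close> by (auto simp: S_def)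
    define c where "c = Max S"
    have "c \<in> S" unfolding c_def using \<open>finite S\<close> \<open>a \<in> S\<close> by (intro Max_in) auto
    then have c: "c < b" "\<And>t. t \<in> S \<Longrightarrow> t \<le> c"
      using \<open>finite S\<close> by (simp add: S_def, simp add: c_def)
    have "a \<le> c" using c(2) \<open>a \<in> S\<close> by blast
    \<comment> \<open>No endpoint lies strictly between c and b, so the member containing this
      midpoint must reach up to b.\<close>
    then have "(c + b) / 2 \<in> {a..b}" using c by auto
    then obtain x K where K: "(x, K) \<in> p" "(c + b) / 2 \<in> K"
      using tagged_division_ofD(6)[OF p] by blast
    obtain u v where uv: "K = {u..v}" "u \<le> v" "a \<le> u" "v \<le> b" "Inf K = u" "Sup K = v"
      using ivl[OF K(1)] by auto
    have "v = b"
    proof (rule ccontr)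
      assume "v \<noteq> b"
      then have "v \<in> S" using uv K(1) by (force simp: S_def)
      then show False using c K(2) uv by fastforce
    qed
    have "u < b" using K(2) uv(1) c(1) by auto
    \<comment> \<open>The second alternative admits one-point members lying left of u; they are
      needed when p' is shown to cover the remaining interval.\<close>
    have other: "L \<subseteq> {a..u}" if L: "(y, L) \<in> p" "Inf L < Sup L \<or> (\<exists>t\<in>L. t < u)" "(y, L) \<noteq> (x, K)" for y L
    proof (rule ccontr)
      obtain l r where lr: "L = {l..r}" "l \<le> r" "a \<le> l" "r \<le> b" "Inf L = l" "Sup L = r"
        using ivl[OF L(1)] by auto
      assume "\<not> L \<subseteq> {a..u}"
      then have "u < r" using lr by auto
      have "max l u < min r b" using L(2) lr \<open>u < b\<close> \<open>u < r\<close> by auto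
      then have "(max l u + min r b) / 2 \<in> interior L \<inter> interior K"
        using lr(1) uv(1) \<open>v = b\<close> by auto
      then show False using tagged_division_ofD(5)[OF p L(1) K(1)] L(3) by auto
    qed
    define p' where "p' = {(y, L) \<in> p. L \<subseteq> {a..u}}"
    have p': "p' \<subseteq> p" "(x, K) \<notin> p'" using uv \<open>u < b\<close> \<open>v = b\<close> by (auto simp: p'_def)
    have nondeg: "{(x, K) \<in> p. Inf K < Sup K} = insert (x, K) {(x, K) \<in> p'. Inf K < Sup K}"
      using other K(1) uv \<open>v = b\<close> \<open>u < b\<close> unfolding p'_def by auto
    have "\<exists>m s y. s 0 = a \<and> s m = u \<and> (\<forall>k<m. s k < s (Suc k)) \<and>
      (\<lambda>k. (y k, {s k..s (Suc k)})) ` {..<m} = {(x, K) \<in> p'. Inf K < Sup K}"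
    proof (cases "a = u")
      case True
      have "\<not> Inf L < Sup L" if "(y, L) \<in> p'" for y L
      proof -
        have "(y, L) \<in> p" "L \<subseteq> {a}" using that True by (auto simp: p'_def)
        then show ?thesis using ivl[of y L] by fastforce
      qed
      then have "{(x, K) \<in> p'. Inf K < Sup K} = {}" by auto
      then show ?thesis using True by (intro exI[of _ 0] exI[of _ "\<lambda>_. a"]) simp
    next
      case False
      then have "a < u" using uv by simp
      have "p' tagged_division_of {a..u}"
      proof (rule tagged_division_ofI)
        show "finite p'" using p'(1) fin by (rule finite_subset)
        fix y L assume yL: "(y, L) \<in> p'"
        then show "y \<in> L" "L \<subseteq> {a..u}" "\<exists>a b. L = cbox a b"
          using tagged_division_ofD(2,4)[OF p] by (auto simp: p'_def)
        fix y' L' assume "(y', L') \<in> p'" "(y, L) \<noteq> (y', L')"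
        then show "interior L \<inter> interior L' = {}"
          using yL p'(1) tagged_division_ofD(5)[OF p] by blast
      next
        let ?U = "\<Union>{L. \<exists>y. (y, L) \<in> p'}"
        have "?U = \<Union>(snd ` p')" by force
        moreover have "closed (\<Union>(snd ` p'))"
        proof (intro closed_Union finite_imageI ballI)
          show "finite p'" using p'(1) fin by (rule finite_subset)
          fix L assume "L \<in> snd ` p'"
          then obtain y where "(y, L) \<in> p" using p'(1) by force
          from ivl[OF this] obtain l r where "L = {l..r}" by blast
          then show "closed L" by simp
        qed
        ultimately have closed: "closed ?U" by simp
        \<comment> \<open>A point left of u is not in the removed member, but u itself is; u is
          recovered by closure, the union being closed.\<close>
        have "{a..<u} \<subseteq> ?U"
        proof
          fix t assume t: "t \<in> {a..<u}"
          then have "t \<in> {a..b}" using \<open>u < b\<close> by auto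
          then obtain y L where L: "(y, L) \<in> p" "t \<in> L"
            using tagged_division_ofD(6)[OF p] by blast
          moreover have "(y, L) \<noteq> (x, K)" using L t uv(1) by auto
          ultimately have "(y, L) \<in> p'" using other[of y L] t by (auto simp: p'_def)
          then show "t \<in> ?U" using L by blast
        qed
        from closure_minimal[OF this closed] have "{a..u} \<subseteq> ?U"
          unfolding closure_atLeastLessThan[OF \<open>a < u\<close>] .
        then show "?U = {a..u}" by (auto simp: p'_def)
      qed
      moreover have "card p' < card p"
        using p' K(1) fin by (intro psubset_card_mono) auto
      ultimately show ?thesis using less.hyps[of p' u] \<open>a < u\<close> by auto
    qed
    then obtain m s y where IH: "s 0 = a" "s m = u" "\<forall>k<m. s k < s (Suc k)"
      "(\<lambda>k. (y k, {s k..s (Suc k)})) ` {..<m} = {(x, K) \<in> p'. Inf K < Sup K}" by blast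
    let ?s = "\<lambda>k. if k \<le> m then s k else b" and ?y = "\<lambda>k. if k < m then y k else x"
    have "(\<lambda>k. (?y k, {?s k..?s (Suc k)})) ` {..<m} = {(x, K) \<in> p'. Inf K < Sup K}"
      unfolding IH(4)[symmetric] by (intro image_cong) auto
    then have "(\<lambda>k. (?y k, {?s k..?s (Suc k)})) ` {..<Suc m} = {(x, K) \<in> p. Inf K < Sup K}"
      unfolding lessThan_Suc nondeg using IH(2) uv(1) \<open>v = b\<close> by simp
    then show ?thesis
      using IH(1-3) \<open>u < b\<close> by (intro exI[of _ "Suc m"] exI[of _ ?s] exI[of _ ?y]) (auto simp: less_Suc_eq)
  qed
qed

text \<open>Turns Riemann-Stieltjes sums into sums along an increasing sequence, with points chosen
  independently of the integrand. One-point members drop out because the increment of g over them is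
  0.\<close>

lemma fine_tagged_division_sorted:
  fixes g :: "real \<Rightarrow> complex"
  assumes p: "p tagged_division_of {a..b}" and "a \<le> b" and fine: "(\<lambda>x. ball x \<delta>) fine p"
    and B: "\<forall>d. d division_of {a..b} \<longrightarrow> (\<Sum>K\<in>d. norm (g (Sup K) - g (Inf K))) \<le> B"
  obtains m s x where "s 0 = a" "s m = b" "\<And>k. k < m \<Longrightarrow> s k < s (Suc k)"
    "\<And>k. k < m \<Longrightarrow> x k \<in> {s k..s (Suc k)}"
    "\<And>k. k < m \<Longrightarrow> {s k..s (Suc k)} \<subseteq> ball (x k) \<delta>"
    "(\<Sum>k<m. norm (g (s (Suc k)) - g (s k))) \<le> B"
    "\<And>h. (\<Sum>(x, K)\<in>p. h x * (g (Sup K) - g (Inf K))) = (\<Sum>k<m. h (x k) * (g (s (Suc k)) - g (s k)))"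
proof -
  from tagged_division_nondegenerate_sorted[OF p \<open>a \<le> b\<close>]
  obtain m s x where s: "s 0 = a" "s m = b" "\<And>k. k < m \<Longrightarrow> s k < s (Suc k)"
    and img: "(\<lambda>k. (x k, {s k..s (Suc k)})) ` {..<m} = {(x, K) \<in> p. Inf K < Sup K}" by blast
  have fin: "finite p" by (rule tagged_division_of_finite[OF p])
  have mem: "(x k, {s k..s (Suc k)}) \<in> p" if "k < m" for k
    using img that by blast
  have mono: "s k < s l" if "k < l" "l \<le> m" for k l
    using that
  proof (induction l)
    case (Suc l)
    then show ?case using s(3)[of l] by (cases "k = l") auto
  qed simp
  have InfSup: "Inf {s k..s (Suc k)} = s k" "Sup {s k..s (Suc k)} = s (Suc k)" if "k < m" for k
    using s(3)[OF that] by simp_all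
  have inj: "inj_on (\<lambda>k. {s k..s (Suc k)}) {..<m}"
  proof (rule inj_onI)
    fix k l assume kl: "k \<in> {..<m}" "l \<in> {..<m}" "{s k..s (Suc k)} = {s l..s (Suc l)}"
    then have "s k = s l" using InfSup(1)[of k] InfSup(1)[of l] by (metis lessThan_iff)
    then show "k = l" using mono[of k l] mono[of l k] kl by (cases k l rule: linorder_cases) auto
  qed
  then have inj': "inj_on (\<lambda>k. (x k, {s k..s (Suc k)})) {..<m}"
    by (auto simp: inj_on_def)
  show thesis
  proof (rule that[of s m x, OF s])
    fix k assume k: "k < m"
    show "x k \<in> {s k..s (Suc k)}" by (rule tagged_division_ofD(2)[OF p mem[OF k]])
    show "{s k..s (Suc k)} \<subseteq> ball (x k) \<delta>" using fine mem[OF k] by (auto simp: fine_def)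
  next
    have "(\<Sum>k<m. norm (g (s (Suc k)) - g (s k)))
        = (\<Sum>k<m. norm (g (Sup {s k..s (Suc k)}) - g (Inf {s k..s (Suc k)})))"
      using InfSup by simp
    also have "\<dots> = (\<Sum>K\<in>(\<lambda>k. {s k..s (Suc k)}) ` {..<m}. norm (g (Sup K) - g (Inf K)))"
      using inj by (simp add: sum.reindex)
    also have "\<dots> \<le> (\<Sum>K\<in>snd ` p. norm (g (Sup K) - g (Inf K)))"
      using mem fin by (intro sum_mono2) force+
    also have "\<dots> \<le> B" by (rule B[rule_format, OF division_of_tagged_division[OF p]])
    finally show "(\<Sum>k<m. norm (g (s (Suc k)) - g (s k))) \<le> B" .
  next
    fix h
    have "(\<Sum>(x, K)\<in>p. h x * (g (Sup K) - g (Inf K)))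
      = (\<Sum>(x, K)\<in>{(x, K) \<in> p. Inf K < Sup K}. h x * (g (Sup K) - g (Inf K)))"
    proof (rule sum.mono_neutral_right[OF fin])
      show "\<forall>z\<in>p - {(x, K) \<in> p. Inf K < Sup K}. (case z of (x, K) \<Rightarrow> h x * (g (Sup K) - g (Inf K))) = 0"
      proof
        fix z assume z: "z \<in> p - {(x, K) \<in> p. Inf K < Sup K}"
        obtain y K where yK: "z = (y, K)" by (cases z)
        with z have K: "(y, K) \<in> p" "\<not> Inf K < Sup K" by auto
        obtain l r where "K = {l..r}" using tagged_division_ofD(4)[OF p K(1)] by auto
        moreover have "y \<in> K" by (rule tagged_division_ofD(2)[OF p K(1)])
        ultimately have "l = r" "K = {l..r}" using K(2) by auto
        then show "(case z of (x, K) \<Rightarrow> h x * (g (Sup K) - g (Inf K))) = 0" by (simp add: yK)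
      qed
    qed auto
    also have "\<dots> = (\<Sum>k<m. h (x k) * (g (s (Suc k)) - g (s k)))"
      unfolding img[symmetric] by (subst sum.reindex[OF inj']) (simp add: InfSup)
    finally show "(\<Sum>(x, K)\<in>p. h x * (g (Sup K) - g (Inf K))) = (\<Sum>k<m. h (x k) * (g (s (Suc k)) - g (s k)))" .
  qed
qed

section \<open>The Riemann-Stieltjes index as a winding number\<close>

lemma circle_param_loop:
  assumes "continuous_on (sphere 0 1) \<gamma>"
  shows "path (circle_param \<gamma>)" and "circle_param \<gamma> 1 = circle_param \<gamma> 0"
    and "path_image (circle_param \<gamma>) = curve_image \<gamma>"
proof -
  show "path (circle_param \<gamma>)"
    unfolding path_def circle_param_def
    by (rule continuous_on_compose2[OF assms]) (auto intro!: continuous_intros)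
  show "circle_param \<gamma> 1 = circle_param \<gamma> 0"
    by (simp add: circle_param_def)
  have "sphere 0 1 = (\<lambda>t. cis (2 * pi * t)) ` {0..1}"
  proof
    show "sphere 0 1 \<subseteq> (\<lambda>t. cis (2 * pi * t)) ` {0..1}"
    proof
      fix w :: complex assume "w \<in> sphere 0 1"
      then have "w = cis (2 * pi * (Arg2pi w / (2 * pi)))"
        using Arg2pi_eq[of w] by (simp add: cis_conv_exp)
      moreover have "Arg2pi w / (2 * pi) \<in> {0..1}"
        using Arg2pi_ge_0[of w] Arg2pi_lt_2pi[of w] by simp
      ultimately show "w \<in> (\<lambda>t. cis (2 * pi * t)) ` {0..1}" by blast
    qed
  qed auto
  then show "path_image (circle_param \<gamma>) = curve_image \<gamma>"
    by (auto simp: path_image_def curve_image_def circle_param_def image_image)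
qed

lemma path_uniform:
  assumes "path g" and "\<kappa> > 0"
  obtains \<delta> where "\<delta> > 0"
    "\<And>s t. s \<in> {0..1} \<Longrightarrow> t \<in> {0..1} \<Longrightarrow> \<bar>s - t\<bar> < \<delta> \<Longrightarrow> norm (g s - g t) < \<kappa>"
proof -
  have "uniformly_continuous_on {0..1} g"
    using assms(1) by (intro compact_uniformly_continuous) (auto simp: path_def)
  then show thesis
    using that \<open>\<kappa> > 0\<close> unfolding uniformly_continuous_on_def dist_norm by (metis real_norm_def)
qed

text \<open>Both terms are compared with (b - a) / (a - z): the quadratic error of the logarithm
  accounts for 2 of the constant 3, and moving the pole term from c to a for the remaining
  1.\<close>

lemma Ln_increment_approx:
  fixes a b c z :: complex
  assumes "r > 0" and "norm (a - z) \<ge> r" and "norm (c - z) \<ge> r"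
    and "norm (b - a) \<le> \<kappa>" and "norm (c - a) \<le> \<kappa>" and "\<kappa> \<le> r / 2"
  shows "norm (1 / (c - z) * (b - a) - Ln ((b - z) / (a - z))) \<le> 3 * \<kappa> / r\<^sup>2 * norm (b - a)"
proof -
  have "\<kappa> \<ge> 0" using assms(4) norm_ge_zero order_trans by blast
  define u where "u = (b - a) / (a - z)"
  have ne: "a \<noteq> z" "c \<noteq> z" using assms by auto
  have nu: "norm u \<le> norm (b - a) / r"
    unfolding u_def norm_divide using assms(1,2) by (intro divide_left_mono mult_pos_pos) auto
  also have "\<dots> \<le> 1 / 2" using assms by (simp add: field_simps)
  finally have half: "norm u \<le> 1 / 2" .
  have "(b - z) / (a - z) = 1 + u" using ne by (simp add: u_def field_simps)
  then have "norm (Ln ((b - z) / (a - z)) - u) \<le> (norm u)\<^sup>2 / (1 - norm u)"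
    using Ln_approx_linear[of u] half by simp
  also have "\<dots> \<le> (norm u)\<^sup>2 / (1 / 2)"
    using half by (intro divide_left_mono) auto
  also have "\<dots> \<le> 2 * (norm (b - a) / r)\<^sup>2"
    using nu by (simp add: power_mono)
  also have "\<dots> = 2 * norm (b - a) / r\<^sup>2 * norm (b - a)"
    by (simp add: power2_eq_square)
  also have "\<dots> \<le> 2 * \<kappa> / r\<^sup>2 * norm (b - a)"
    using assms by (intro mult_right_mono divide_right_mono mult_left_mono) auto
  finally have 1: "norm (Ln ((b - z) / (a - z)) - u) \<le> 2 * \<kappa> / r\<^sup>2 * norm (b - a)" .
  have "1 / (c - z) * (b - a) - u = (a - c) / ((c - z) * (a - z)) * (b - a)"
    using ne by (simp add: u_def field_simps)
  then have "norm (1 / (c - z) * (b - a) - u) = norm (a - c) / (norm (c - z) * norm (a - z)) * norm (b - a)"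
    by (simp add: norm_mult norm_divide)
  also have "\<dots> \<le> \<kappa> / (r * r) * norm (b - a)"
    using assms by (intro mult_right_mono frac_le mult_mono) (auto simp: norm_minus_commute \<open>\<kappa> \<ge> 0\<close>)
  finally have 2: "norm (1 / (c - z) * (b - a) - u) \<le> \<kappa> / r\<^sup>2 * norm (b - a)"
    by (simp add: power2_eq_square)
  have "norm (1 / (c - z) * (b - a) - Ln ((b - z) / (a - z)))
     \<le> norm (1 / (c - z) * (b - a) - u) + norm (Ln ((b - z) / (a - z)) - u)"
    by (metis norm_triangle_ineq4 diff_diff_eq2 diff_add_cancel add_diff_cancel_right)
  also have "\<dots> \<le> \<kappa> / r\<^sup>2 * norm (b - a) + 2 * \<kappa> / r\<^sup>2 * norm (b - a)"
    using 1 2 by simp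
  finally show ?thesis by (simp add: algebra_simps add_divide_distrib)
qed

text \<open>On each short subinterval the term of the Riemann-Stieltjes sum approximates the
  increment of a continuous logarithm, with an error proportional to the increment of the curve;
  bounded variation makes the errors summable.\<close>

lemma curve_index_eq_winding_number:
  assumes \<gamma>: "closed_rectifiable_curve \<gamma>" and z: "z \<notin> curve_image \<gamma>"
  shows "curve_index \<gamma> z = winding_number (circle_param \<gamma>) z"
proof -
  let ?g = "circle_param \<gamma>"
  have g: "path ?g" "?g 1 = ?g 0" "path_image ?g = curve_image \<gamma>"
    using \<gamma> circle_param_loop by (auto simp: closed_rectifiable_curve_def)
  have z: "z \<notin> path_image ?g" using z g by simp
  obtain lg where lg: "path lg" "pathfinish lg - pathstart lg = 2 * of_real pi * \<i> * winding_number ?g z"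
    "\<And>t. t \<in> {0..1} \<Longrightarrow> ?g t = z + exp (lg t)"
    using winding_number_as_continuous_log[OF g(1) z] by metis
  obtain B where B: "\<forall>d. d division_of {0..1} \<longrightarrow> (\<Sum>K\<in>d. norm (?g (Sup K) - ?g (Inf K))) \<le> B"
    using \<gamma> by (auto simp: closed_rectifiable_curve_def bounded_variation_on_interval_def)
  have "{{0..1::real}} division_of {0..1}" using division_of_self[of "0::real" 1] by simp
  from B[rule_format, OF this] have "B \<ge> 0" by (rule order_trans[rotated]) simp
  obtain r where r: "r > 0" "\<And>t. t \<in> {0..1} \<Longrightarrow> norm (?g t - z) \<ge> r"
    using separate_point_closed[OF closed_path_image[OF g(1)] z]
    by (auto simp: path_image_def dist_norm norm_minus_commute)
  have "has_RS_integral (\<lambda>t. 1 / (?g t - z)) ?g (lg 1 - lg 0) 0 1"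
    unfolding has_RS_integral_def
  proof (intro allI impI)
    fix e :: real assume "e > 0"
    \<comment> \<open>The first bound is what \<open>Ln_increment_approx\<close> asks for; the
      second makes the total error \<open>3 * \<kappa> / r\<^sup>2 * B\<close> less than e, with B +
      1 to exclude division by 0.\<close>
    define \<kappa> where "\<kappa> = min (r / 2) (e * r\<^sup>2 / (3 * (B + 1)))"
    have \<kappa>: "\<kappa> > 0" using r(1) \<open>e > 0\<close> \<open>B \<ge> 0\<close> by (simp add: \<kappa>_def)
    have \<kappa>_le: "\<kappa> \<le> r / 2" "\<kappa> \<le> e * r\<^sup>2 / (3 * (B + 1))"
      unfolding \<kappa>_def by (rule min.cobounded1, rule min.cobounded2)
    obtain \<delta> where \<delta>: "\<delta> > 0"
      "\<And>s t. s \<in> {0..1} \<Longrightarrow> t \<in> {0..1} \<Longrightarrow> \<bar>s - t\<bar> < \<delta> \<Longrightarrow> norm (?g s - ?g t) < \<kappa>"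
      using path_uniform[OF g(1) \<kappa>] by blast
    \<comment> \<open>Half of \<delta>, because two points of one subinterval are compared through
      the tag.\<close>
    show "\<exists>\<delta>>0. \<forall>p. p tagged_division_of {0..1} \<and> (\<lambda>x. ball x \<delta>) fine p \<longrightarrow>
       norm ((\<Sum>(x, K)\<in>p. 1 / (?g x - z) * (?g (Sup K) - ?g (Inf K))) - (lg 1 - lg 0)) < e"
    proof (intro exI[of _ "\<delta> / 2"] conjI allI impI; (elim conjE)?)
      show "\<delta> / 2 > 0" using \<delta> by simp
      fix p :: "(real \<times> real set) set"
      assume p: "p tagged_division_of {0..1}" and fine: "(\<lambda>x. ball x (\<delta> / 2)) fine p"
      obtain m s x where s: "s 0 = 0" "s m = 1" "\<And>k. k < m \<Longrightarrow> s k < s (Suc k)"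
        "\<And>k. k < m \<Longrightarrow> x k \<in> {s k..s (Suc k)}"
        "\<And>k. k < m \<Longrightarrow> {s k..s (Suc k)} \<subseteq> ball (x k) (\<delta> / 2)"
        "(\<Sum>k<m. norm (?g (s (Suc k)) - ?g (s k))) \<le> B"
        "\<And>h. (\<Sum>(x, K)\<in>p. h x * (?g (Sup K) - ?g (Inf K))) = (\<Sum>k<m. h (x k) * (?g (s (Suc k)) - ?g (s k)))"
        by (rule fine_tagged_division_sorted[OF p zero_le_one fine B]) (rule that)
      have mono: "s k \<le> s l" if "k \<le> l" "l \<le> m" for k l
        using that
      proof (induction l rule: dec_induct)
        case (step l)
        then show ?case using s(3)[of l] by simp
      qed simp
      have sub: "{s k..s (Suc k)} \<subseteq> {0..1}" if "k < m" for k
        using mono[of 0 k] mono[of "Suc k" m] that s(1,2) by auto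
      have osc: "norm (?g \<tau> - ?g \<sigma>) < \<kappa>" if "k < m" "\<tau> \<in> {s k..s (Suc k)}" "\<sigma> \<in> {s k..s (Suc k)}" for k \<tau> \<sigma>
      proof (rule \<delta>(2))
        have "\<tau> \<in> ball (x k) (\<delta> / 2)" "\<sigma> \<in> ball (x k) (\<delta> / 2)" using s(5)[OF that(1)] that by auto
        then show "\<bar>\<tau> - \<sigma>\<bar> < \<delta>" unfolding mem_ball dist_real_def by linarith
        show "\<tau> \<in> {0..1}" "\<sigma> \<in> {0..1}" using sub[OF that(1)] that(2,3) by blast+
      qed
      have incr: "norm (1 / (?g (x k) - z) * (?g (s (Suc k)) - ?g (s k)) - (lg (s (Suc k)) - lg (s k)))
          \<le> 3 * \<kappa> / r\<^sup>2 * norm (?g (s (Suc k)) - ?g (s k))" if k: "k < m" for k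
      proof -
        have ends: "s k \<in> {s k..s (Suc k)}" "s (Suc k) \<in> {s k..s (Suc k)}" using s(3)[OF k] by auto
        have "lg (s (Suc k)) - lg (s k) = Ln ((?g (s (Suc k)) - z) / (?g (s k) - z))"
        proof (rule continuous_log_increment)
          show "s k \<le> s (Suc k)" using s(3)[OF k] by simp
          show "continuous_on {s k..s (Suc k)} lg"
            using lg(1) sub[OF k] by (auto simp: path_def elim: continuous_on_subset)
          show "?g \<tau> = z + exp (lg \<tau>)" if "\<tau> \<in> {s k..s (Suc k)}" for \<tau>
            by (rule lg(3)[OF subsetD[OF sub[OF k] that]])
          show "norm (?g \<tau> - ?g (s k)) < norm (?g (s k) - z)" if "\<tau> \<in> {s k..s (Suc k)}" for \<tau>
            using osc[OF k that ends(1)] r(2)[OF subsetD[OF sub[OF k] ends(1)]] \<kappa>_le(1) r(1) by linarith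
        qed
        moreover have "norm (1 / (?g (x k) - z) * (?g (s (Suc k)) - ?g (s k)) - Ln ((?g (s (Suc k)) - z) / (?g (s k) - z)))
            \<le> 3 * \<kappa> / r\<^sup>2 * norm (?g (s (Suc k)) - ?g (s k))"
        proof (rule Ln_increment_approx[OF r(1)])
          show "norm (?g (s k) - z) \<ge> r" "norm (?g (x k) - z) \<ge> r"
            using r(2) subsetD[OF sub[OF k]] ends s(4)[OF k] by blast+
          show "norm (?g (s (Suc k)) - ?g (s k)) \<le> \<kappa>" "norm (?g (x k) - ?g (s k)) \<le> \<kappa>"
            using less_imp_le[OF osc[OF k]] ends s(4)[OF k] by blast+
        qed (rule \<kappa>_le(1))
        ultimately show ?thesis by simp
      qed
      have lg_sum: "(\<Sum>k<m. lg (s (Suc k)) - lg (s k)) = lg 1 - lg 0"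
        using sum_lessThan_telescope[of "\<lambda>k. lg (s k)" m] s(1,2) by simp
      have "(\<Sum>(x, K)\<in>p. 1 / (?g x - z) * (?g (Sup K) - ?g (Inf K))) - (lg 1 - lg 0)
        = (\<Sum>k<m. 1 / (?g (x k) - z) * (?g (s (Suc k)) - ?g (s k)) - (lg (s (Suc k)) - lg (s k)))"
        unfolding s(7) lg_sum[symmetric] by (rule sum_subtractf[symmetric])
      also have "norm \<dots> \<le> (\<Sum>k<m. 3 * \<kappa> / r\<^sup>2 * norm (?g (s (Suc k)) - ?g (s k)))"
        using incr by (intro sum_norm_le) simp
      also have "\<dots> \<le> 3 * \<kappa> / r\<^sup>2 * B"
        unfolding sum_distrib_left[symmetric] using s(6) \<kappa> r(1) by (intro mult_left_mono) auto
      also have "\<dots> < 3 * \<kappa> / r\<^sup>2 * (B + 1)"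
        using \<kappa> r(1) by (intro mult_strict_left_mono) auto
      also have "\<dots> \<le> e" using \<kappa>_le(2) r(1) \<open>B \<ge> 0\<close> by (simp add: field_simps)
      finally show "norm ((\<Sum>(x, K)\<in>p. 1 / (?g x - z) * (?g (Sup K) - ?g (Inf K))) - (lg 1 - lg 0)) < e" .
    qed
  qed
  then have "curve_integral \<gamma> (\<lambda>w. 1 / (w - z)) = lg 1 - lg 0"
    by (intro curve_integral_unique) (simp add: has_curve_integral_def)
  then show ?thesis
    using lg(2) by (simp add: curve_index_def pathfinish_def pathstart_def)
qed

section \<open>The integral over the curve\<close>

lemma norm_sum_interval_diff_sub_le:
  fixes h :: "int \<Rightarrow> complex" and e :: real
  assumes bounds: "\<bar>x\<bar> \<le> R" "\<bar>x'\<bar> \<le> R"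
    and h: "\<And>i. interval_diff x x' i \<noteq> 0 \<Longrightarrow> norm (h i - c) \<le> e"
  shows "norm ((\<Sum>i\<in>{-R..R}. of_int (interval_diff x x' i) * h i) - of_int (x' - x) * c) \<le> e * of_int \<bar>x' - x\<bar>"
proof -
  have "of_int (x' - x) * c = (\<Sum>i\<in>{-R..R}. of_int (interval_diff x x' i) * c)"
    unfolding sum_interval_diff[OF bounds, symmetric] of_int_sum by (rule sum_distrib_right)
  then have "(\<Sum>i\<in>{-R..R}. of_int (interval_diff x x' i) * h i) - of_int (x' - x) * c
      = (\<Sum>i\<in>{-R..R}. of_int (interval_diff x x' i) * (h i - c))"
    by (simp add: right_diff_distrib sum_subtractf)
  also have "norm \<dots> \<le> (\<Sum>i\<in>{-R..R}. e * of_int \<bar>interval_diff x x' i\<bar>)"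
  proof (rule sum_norm_le)
    fix i
    show "norm (of_int (interval_diff x x' i) * (h i - c)) \<le> e * of_int \<bar>interval_diff x x' i\<bar>"
    proof (cases "interval_diff x x' i = 0")
      case False
      have "norm (of_int (interval_diff x x' i) * (h i - c)) = norm (h i - c) * of_int \<bar>interval_diff x x' i\<bar>"
        by (simp add: norm_mult)
      also have "\<dots> \<le> e * of_int \<bar>interval_diff x x' i\<bar>"
        by (intro mult_right_mono h False) simp
      finally show ?thesis .
    qed simp
  qed
  also have "\<dots> = e * of_int \<bar>x' - x\<bar>"
    unfolding sum_distrib_left[symmetric] of_int_sum[symmetric] sum_abs_interval_diff[OF bounds] ..
  finally show ?thesis .
qed

text \<open>For a constant function the L-shaped path and the straight increment give the same
  value, so only the oscillation times the l1 length remains.\<close>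

lemma norm_sum_edges_sub_le:
  assumes "d > 0" and F: "continuous_on UNIV F" and "e \<ge> 0"
    and bounds: "\<bar>x\<bar> \<le> R" "\<bar>x'\<bar> \<le> R" "\<bar>y\<bar> \<le> R" "\<bar>y'\<bar> \<le> R"
    and near: "\<And>w. norm (w - gpt d x y) \<le> d * of_int (\<bar>x' - x\<bar> + \<bar>y' - y\<bar>) \<Longrightarrow> norm (F w - F (gpt d x y)) \<le> e"
  shows "norm ((\<Sum>i\<in>{-R..R}. of_int (interval_diff x x' i) * hedge d F i y)
    + (\<Sum>j\<in>{-R..R}. of_int (interval_diff y y' j) * vedge d F x' j)
    - F (gpt d x y) * (gpt d x' y' - gpt d x y)) \<le> e * (d * of_int (\<bar>x' - x\<bar> + \<bar>y' - y\<bar>))"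
proof -
  let ?c = "F (gpt d x y)"
  have mono: "d * real_of_int a \<le> d * of_int b" if "a \<le> b" for a b
    using that \<open>d > 0\<close> by simp
  have box: "norm (F w - ?c) \<le> e"
    if "d * min x x' \<le> Re w" "Re w \<le> d * max x x'" "d * min y y' \<le> Im w" "Im w \<le> d * max y y'" for w
  proof (rule near)
    have *: "\<bar>t - d * i\<bar> \<le> d * of_int \<bar>i' - i\<bar>"
      if "d * of_int (min i i') \<le> t" "t \<le> d * of_int (max i i')" for t :: real and i i' :: int
      using that by (cases "i \<le> i'") (auto simp: min_def max_def abs_le_iff algebra_simps)
    have "norm (w - gpt d x y) \<le> \<bar>Re w - d * x\<bar> + \<bar>Im w - d * y\<bar>"
      using dist_le_abs_Re_Im[of w "gpt d x y"] by (simp add: gpt_def)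
    also have "\<dots> \<le> d * of_int \<bar>x' - x\<bar> + d * of_int \<bar>y' - y\<bar>"
      using *[OF that(1,2)] *[OF that(3,4)] by simp
    finally show "norm (w - gpt d x y) \<le> d * of_int (\<bar>x' - x\<bar> + \<bar>y' - y\<bar>)"
      by (simp add: distrib_left)
  qed
  have 1: "norm ((\<Sum>i\<in>{-R..R}. of_int (interval_diff x x' i) * hedge d F i y) - of_int (x' - x) * (?c * d))
      \<le> (e * d) * of_int \<bar>x' - x\<bar>"
  proof (rule norm_sum_interval_diff_sub_le[OF bounds(1,2)])
    fix i assume "interval_diff x x' i \<noteq> 0"
    then have "min x x' \<le> i" "i + 1 \<le> max x x'" "min y y' \<le> y" "y \<le> max y y'"
      using interval_diff_nonzeroD by fastforce+
    from this[THEN mono] show "norm (hedge d F i y - ?c * d) \<le> e * d"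
      by (intro norm_hedge_sub_le[OF assms(1) F assms(3)] box) simp_all
  qed
  have 2: "norm ((\<Sum>j\<in>{-R..R}. of_int (interval_diff y y' j) * vedge d F x' j) - of_int (y' - y) * (?c * (\<i> * d)))
      \<le> (e * d) * of_int \<bar>y' - y\<bar>"
  proof (rule norm_sum_interval_diff_sub_le[OF bounds(3,4)])
    fix i assume "interval_diff y y' i \<noteq> 0"
    then have "min y y' \<le> i" "i + 1 \<le> max y y'" "min x x' \<le> x'" "x' \<le> max x x'"
      using interval_diff_nonzeroD by fastforce+
    from this[THEN mono] show "norm (vedge d F x' i - ?c * (\<i> * d)) \<le> e * d"
      by (intro norm_vedge_sub_le[OF assms(1) F assms(3)] box) simp_all
  qed
  have g: "gpt d x' y' - gpt d x y = of_int (x' - x) * d + of_int (y' - y) * (\<i> * d)"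
    by (simp add: gpt_diff complex_eq_iff)
  have "norm (a + b - (a' + b')) \<le> norm (a - a') + norm (b - b')" for a b a' b' :: complex
    by (metis add_diff_add norm_triangle_ineq)
  from order_trans[OF this add_mono[OF 1 2]] show ?thesis
    unfolding g by (simp add: algebra_simps)
qed

text \<open>The bound stays small for arbitrarily fine sequences of points: \<open>e1\<close> is the modulus of
  continuity at the scale \<open>\<eta>\<close> separating small from large perimeters of superlevel sets of the
  index, and \<open>e2\<close> the one at the much finer scale \<open>d\<close> of the grid.\<close>

lemma norm_curve_sum_le:
  fixes g :: "real \<Rightarrow> complex" and d e1 e2 \<eta> B :: real
  assumes "path g" and loop: "g 1 = g 0"
    and F: "continuous_on UNIV F" and hol: "F holomorphic_on {z. z \<notin> path_image g \<and> winding_number g z \<noteq> 0}"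
    and "0 < d" "d \<le> 1" "e1 \<ge> 0" "e2 \<ge> 0" "\<eta> > 0"
    and unif1: "\<And>a b. norm (a - b) \<le> \<eta> \<Longrightarrow> norm (F a - F b) \<le> e1"
    and unif2: "\<And>a b. norm (a - b) \<le> 8 * d \<Longrightarrow> norm (F a - F b) \<le> e2"
    and s: "s 0 = 0" "s m = 1" "\<And>k. k < m \<Longrightarrow> s k < s (Suc k)"
    and x: "\<And>k. k < m \<Longrightarrow> x k \<in> {s k..s (Suc k)}"
    and osc: "\<And>k \<tau>. k < m \<Longrightarrow> \<tau> \<in> {s k..s (Suc k)} \<Longrightarrow> norm (g \<tau> - g (s k)) \<le> d"
    and B: "(\<Sum>k<m. norm (g (s (Suc k)) - g (s k))) \<le> B"
  defines "W \<equiv> 4 * B + 3"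
  shows "norm (\<Sum>k<m. F (g (x k)) * (g (s (Suc k)) - g (s k)))
    \<le> e2 * (B + 4 * W) + 2 * W * (e1 + 4 * e2 * (1681 * (1 + W)) / \<eta>)"
proof -
  have "B \<ge> 0" using B by (rule order_trans[rotated]) (simp add: sum_nonneg)
  define p where "p k = g (s k)" for k
  have h1: "norm (p (Suc k) - p k) \<le> d" if "k < m" for k
    using osc[OF that, of "s (Suc k)"] s(3)[OF that] by (simp add: p_def)
  have h2: "p m = p 0" using s loop by (simp add: p_def)
  have h3: "(\<Sum>k<m. norm (p (Suc k) - p k)) \<le> B" using B by (simp add: p_def)
  obtain X Y :: "nat \<Rightarrow> int" where XY: "X (Suc m) = X 0" "Y (Suc m) = Y 0"
    "\<And>k. k \<le> m \<Longrightarrow> norm1 (p k - gpt d (X k) (Y k)) \<le> 3 * d"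
    "\<And>k. k \<le> m \<Longrightarrow> \<bar>X (Suc k) - X k\<bar> + \<bar>Y (Suc k) - Y k\<bar> \<le> 6"
    "d * (\<Sum>k<Suc m. \<bar>X (Suc k) - X k\<bar> + \<bar>Y (Suc k) - Y k\<bar>) \<le> 4 * B + 3 * d"
    "\<And>k. k > m \<Longrightarrow> X k = X 0 \<and> Y k = Y 0"
    by (rule hysteresis_rounding[OF \<open>d > 0\<close> _ h2 h3]) (rule h1, assumption, rule that)
  define R where "R = 1 + (\<Sum>k\<le>m. \<bar>X k\<bar> + \<bar>Y k\<bar>)"
  have R: "\<bar>X k\<bar> + \<bar>Y k\<bar> < R" for k
  proof -
    have *: "\<bar>X k\<bar> + \<bar>Y k\<bar> < R" if "k \<le> m" for k
      using member_le_sum[of k "{..m}" "\<lambda>k. \<bar>X k\<bar> + \<bar>Y k\<bar>"] that by (simp add: R_def)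
    show ?thesis using *[of k] *[of 0] XY(6)[of k] by (cases "k \<le> m") auto
  qed
  interpret lattice_loop X Y "Suc m" R
  proof
    show "\<bar>X k\<bar> < R" "\<bar>Y k\<bar> < R" for k using R[of k] by auto
  qed (use XY in auto)
  \<comment> \<open>During the extra closing step of the rounded path the curve rests at parameter
    1.\<close>
  define s' where "s' k = (if k \<le> m then s k else 1)" for k
  define P where "P k = g (s' k)" for k
  define Q where "Q k = gpt d (X k) (Y k)" for k
  have PS: "P (Suc m) = P m" "P (Suc m) = P 0" and Pp: "\<And>k. k \<le> m \<Longrightarrow> P k = p k"
    using s loop by (simp_all add: P_def s'_def p_def)
  have PQ: "norm (P k - Q k) \<le> 3 * d" if "k \<le> Suc m" for k
  proof (cases "k \<le> m")
    case True
    then show ?thesis using XY(3)[of k] norm_le_norm1 Pp order_trans unfolding Q_def by metis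
  next
    case False
    then have "k = Suc m" using that by simp
    then show ?thesis
      using XY(3)[of 0] norm_le_norm1[of "P 0 - Q 0"] Pp[of 0] PS XY(1,2) unfolding Q_def by simp
  qed
  have dlen: "d * len \<le> W"
  proof -
    have "d * len \<le> 4 * B + 3 * d" using XY(5) by (simp only: len_def)
    then show ?thesis using \<open>d \<le> 1\<close> by (simp add: W_def)
  qed
  have len0: "0 \<le> real_of_int len" by (simp add: len_def sum_nonneg)
  then have "0 \<le> d * len" using \<open>d > 0\<close> by simp
  let ?I = "\<Sum>i\<in>{-R..R}. \<Sum>j\<in>{-R..R}. of_int (wind i j) * cellint d F i j"
  have s'_ends: "s' 0 = 0" "s' (Suc m) = 1" using s by (auto simp: s'_def)
  have s'_mono: "s' k \<le> s' (Suc k)" if "k < Suc m" for k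
    using that s(2) s(3)[of k] by (cases "k = m") (auto simp: s'_def)
  have s'_osc: "norm (g \<tau> - g (s' k)) \<le> d" if k: "k < Suc m" and \<tau>: "\<tau> \<in> {s' k..s' (Suc k)}" for k \<tau>
  proof (cases "k < m")
    case True
    then show ?thesis using osc[of k \<tau>] \<tau> by (simp add: s'_def)
  next
    case False
    then have "k = m" using k by simp
    then have "\<tau> = s' k" using \<tau> s(2) by (simp add: s'_def)
    then show ?thesis using \<open>d > 0\<close> by simp
  qed
  have s'_dist: "norm1 (g (s' k) - gpt d (X k) (Y k)) \<le> 3 * d" if "k \<le> Suc m" for k
  proof (cases "k \<le> m")
    case True
    then show ?thesis using XY(3)[of k] by (simp add: s'_def p_def)
  next
    case False
    then have "k = Suc m" using that by simp
    then show ?thesis using XY(3)[of 0] XY(1,2) s loop by (simp add: s'_def p_def)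
  qed
  have XY_step: "\<bar>X (Suc k) - X k\<bar> + \<bar>Y (Suc k) - Y k\<bar> \<le> 6" if "k < Suc m" for k
    using that XY(4)[of k] by simp
  have zero: "cellint d F a b = 0" if ab: "(a, b) \<notin> near 20" "wind a b \<noteq> 0" for a b
  proof (rule cellint_eq_0[OF \<open>d > 0\<close>], rule holomorphic_on_subset[OF hol])
    have disj: "gcell d a b \<inter> path_image g = {}"
      by (rule wind_eq_winding_number(1)[OF \<open>d > 0\<close> \<open>path g\<close> s'_ends _ loop _ _ _ ab])
         (fact s'_mono s'_osc s'_dist XY_step)+
    have wn: "winding_number g (gcenter d a b) = wind a b"
      by (rule wind_eq_winding_number(2)[OF \<open>d > 0\<close> \<open>path g\<close> s'_ends _ loop _ _ _ ab])
         (fact s'_mono s'_osc s'_dist XY_step)+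
    have c: "gcenter d a b \<in> gcell d a b"
      using \<open>d > 0\<close> by (auto simp: in_cbox_complex_iff gpt_def gcenter_def)
    have closed: "pathfinish g = pathstart g" using loop by (simp add: pathfinish_def pathstart_def)
    show "gcell d a b \<subseteq> {z. z \<notin> path_image g \<and> winding_number g z \<noteq> 0}"
    proof
      fix z assume z: "z \<in> gcell d a b"
      have "winding_number g z = winding_number g (gcenter d a b)"
        by (rule winding_number_eq[OF \<open>path g\<close> closed z c convex_connected[OF convex_box(1)] disj])
      then show "z \<in> {z. z \<notin> path_image g \<and> winding_number g z \<noteq> 0}"
        using wn ab(2) z disj by (simp del: mem_box) blast
    qed
  qed
  have "norm ?I \<le> 2 * (d * len) * (e1 + 4 * e2 * (d * ((2 * (20::int) + 1)\<^sup>2 * (1 + len))) / \<eta>)"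
    using zero unif1 unif2 assms(5-9)
    by (intro norm_sum_wind_cellint_le F) auto
  also have "\<dots> \<le> 2 * W * (e1 + 4 * e2 * (1681 * (1 + W)) / \<eta>)"
  proof -
    \<comment> \<open>1681 is the square of 41 = 2 * 20 + 1, the number of squares around one
      lattice point.\<close>
    have "d * ((2 * real_of_int 20 + 1)\<^sup>2 * (1 + len)) = 1681 * (d + d * len)"
      by (simp add: algebra_simps)
    also have "\<dots> \<le> 1681 * (1 + W)" using dlen \<open>d \<le> 1\<close> by simp
    finally have t: "d * ((2 * real_of_int 20 + 1)\<^sup>2 * (1 + len)) \<le> 1681 * (1 + W)" .
    have "2 * (d * len) * (e1 + 4 * e2 * t / \<eta>) \<le> 2 * W * (e1 + 4 * e2 * u / \<eta>)"
      if "t \<le> u" "0 \<le> t" for t u :: real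
      using dlen \<open>0 \<le> d * len\<close> assms(5-9) that
      by (intro mult_mono add_mono divide_right_mono mult_left_mono add_nonneg_nonneg divide_nonneg_pos mult_nonneg_nonneg) auto
    from this[OF t] show ?thesis using len0 \<open>d > 0\<close> by simp
  qed
  finally have I: "norm ?I \<le> 2 * W * (e1 + 4 * e2 * (1681 * (1 + W)) / \<eta>)" .
  have dQ: "norm (Q (Suc k) - Q k) \<le> 6 * d" and dQ1: "d * of_int (\<bar>X (Suc k) - X k\<bar> + \<bar>Y (Suc k) - Y k\<bar>) \<le> 6 * d"
    if "k \<le> m" for k
  proof -
    have "d * of_int (\<bar>X (Suc k) - X k\<bar> + \<bar>Y (Suc k) - Y k\<bar>) \<le> d * of_int 6"
      using XY(4)[OF that] \<open>d > 0\<close> by (simp only: mult_le_cancel_left_pos of_int_le_iff)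
    then show 1: "d * of_int (\<bar>X (Suc k) - X k\<bar> + \<bar>Y (Suc k) - Y k\<bar>) \<le> 6 * d" by simp
    have "norm (Q (Suc k) - Q k) \<le> d * of_int (\<bar>X (Suc k) - X k\<bar> + \<bar>Y (Suc k) - Y k\<bar>)"
      using norm_le_norm1 norm1_gpt_diff[OF \<open>d > 0\<close>] unfolding Q_def by metis
    then show "norm (Q (Suc k) - Q k) \<le> 6 * d" using 1 by simp
  qed
  have A3: "norm (?I - (\<Sum>k<Suc m. F (Q k) * (Q (Suc k) - Q k))) \<le> e2 * (d * len)"
  proof -
    have "norm (?I - (\<Sum>k<Suc m. F (Q k) * (Q (Suc k) - Q k)))
      \<le> (\<Sum>k<Suc m. e2 * (d * of_int (\<bar>X (Suc k) - X k\<bar> + \<bar>Y (Suc k) - Y k\<bar>)))"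
      unfolding sum_wind_cell sum_subtractf[symmetric]
    proof (rule sum_norm_le)
      fix k assume "k \<in> {..<Suc m}"
      then have k: "k \<le> m" by simp
      show "norm ((\<Sum>i\<in>{-R..R}. of_int (interval_diff (X k) (X (Suc k)) i) * hedge d F i (Y k))
         + (\<Sum>j\<in>{-R..R}. of_int (interval_diff (Y k) (Y (Suc k)) j) * vedge d F (X (Suc k)) j)
         - F (Q k) * (Q (Suc k) - Q k)) \<le> e2 * (d * of_int (\<bar>X (Suc k) - X k\<bar> + \<bar>Y (Suc k) - Y k\<bar>))"
        unfolding Q_def
      proof (rule norm_sum_edges_sub_le[OF \<open>d > 0\<close> F \<open>e2 \<ge> 0\<close>])
        fix w assume "norm (w - gpt d (X k) (Y k)) \<le> d * of_int (\<bar>X (Suc k) - X k\<bar> + \<bar>Y (Suc k) - Y k\<bar>)"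
        then show "norm (F w - F (gpt d (X k) (Y k))) \<le> e2"
          using dQ1[OF k] \<open>d > 0\<close> by (intro unif2) linarith
      qed (rule less_imp_le, rule boundX boundY)+
    qed
    also have "\<dots> = e2 * (d * len)"
      by (simp only: len_def sum_distrib_left of_int_sum)
    finally show ?thesis .
  qed
  \<comment> \<open>The increments of P - Q need not have a small total variation, so they are moved
    onto F: P - Q is at most 3 d, and F along Q changes only at jumps, each of which has length at
    least d and so pays for this error.\<close>
  have A2: "norm (\<Sum>k<Suc m. F (Q k) * ((P (Suc k) - Q (Suc k)) - (P k - Q k))) \<le> 3 * e2 * (d * len)"
  proof -
    have "(\<Sum>k<Suc m. F (Q k) * ((P (Suc k) - Q (Suc k)) - (P k - Q k)))
       = - (\<Sum>k<Suc m. (F (Q (Suc k)) - F (Q k)) * (P (Suc k) - Q (Suc k)))"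
      using PS XY(1,2) by (intro sum_cyclic_by_parts) (simp_all add: Q_def)
    also have "norm \<dots> \<le> (\<Sum>k<Suc m. 3 * e2 * (d * of_int (\<bar>X (Suc k) - X k\<bar> + \<bar>Y (Suc k) - Y k\<bar>)))"
      unfolding norm_minus_cancel
    proof (rule sum_norm_le)
      fix k assume "k \<in> {..<Suc m}"
      then have k: "k \<le> m" by simp
      show "norm ((F (Q (Suc k)) - F (Q k)) * (P (Suc k) - Q (Suc k)))
          \<le> 3 * e2 * (d * of_int (\<bar>X (Suc k) - X k\<bar> + \<bar>Y (Suc k) - Y k\<bar>))"
      proof (cases "X (Suc k) = X k \<and> Y (Suc k) = Y k")
        case False
        then have "\<bar>X (Suc k) - X k\<bar> + \<bar>Y (Suc k) - Y k\<bar> \<ge> 1" by linarith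
        then have one: "real_of_int (\<bar>X (Suc k) - X k\<bar> + \<bar>Y (Suc k) - Y k\<bar>) \<ge> 1" by linarith
        have "norm ((F (Q (Suc k)) - F (Q k)) * (P (Suc k) - Q (Suc k))) \<le> e2 * (3 * d)"
          unfolding norm_mult using dQ[OF k] PQ[of "Suc k"] k \<open>d > 0\<close> \<open>e2 \<ge> 0\<close>
          by (intro mult_mono unif2) auto
        also have "\<dots> = 3 * e2 * (d * 1)" by simp
        also have "\<dots> \<le> 3 * e2 * (d * of_int (\<bar>X (Suc k) - X k\<bar> + \<bar>Y (Suc k) - Y k\<bar>))"
          using one \<open>d > 0\<close> \<open>e2 \<ge> 0\<close> by (intro mult_left_mono) auto
        finally show ?thesis .
      qed (simp add: Q_def)
    qed
    also have "\<dots> = 3 * e2 * (d * len)"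
      by (simp only: len_def sum_distrib_left of_int_sum)
    finally show ?thesis .
  qed
  have A1: "norm ((\<Sum>k<m. F (g (x k)) * (g (s (Suc k)) - g (s k))) - (\<Sum>k<Suc m. F (Q k) * (P (Suc k) - P k))) \<le> e2 * B"
  proof -
    have "(\<Sum>k<Suc m. F (Q k) * (P (Suc k) - P k)) = (\<Sum>k<m. F (Q k) * (g (s (Suc k)) - g (s k)))"
      using PS Pp by (simp add: p_def)
    then have "(\<Sum>k<m. F (g (x k)) * (g (s (Suc k)) - g (s k))) - (\<Sum>k<Suc m. F (Q k) * (P (Suc k) - P k))
       = (\<Sum>k<m. (F (g (x k)) - F (Q k)) * (g (s (Suc k)) - g (s k)))"
      by (simp add: left_diff_distrib sum_subtractf)
    also have "norm \<dots> \<le> (\<Sum>k<m. e2 * norm (g (s (Suc k)) - g (s k)))"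
    proof (rule sum_norm_le)
      fix k assume "k \<in> {..<m}"
      then have k: "k < m" by simp
      have "norm (g (x k) - Q k) \<le> 8 * d"
        using norm_triangle_ineq[of "g (x k) - P k" "P k - Q k"] osc[OF k x[OF k]] PQ[of k] Pp[of k] k \<open>d > 0\<close>
        by (simp add: p_def)
      then show "norm ((F (g (x k)) - F (Q k)) * (g (s (Suc k)) - g (s k))) \<le> e2 * norm (g (s (Suc k)) - g (s k))"
        unfolding norm_mult by (intro mult_right_mono unif2) auto
    qed
    also have "\<dots> \<le> e2 * B"
      unfolding sum_distrib_left[symmetric] using B \<open>e2 \<ge> 0\<close> by (rule mult_left_mono)
    finally show ?thesis .
  qed
  \<comment> \<open>From T to U the tags are replaced by lattice points, from U to V the increments
    of the curve by lattice increments, and from V to the cell sum the increments by edge integrals.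
    The distances involved are at most 6 d, within the scale 8 d of \<open>e2\<close>.\<close>
  define T where "T = (\<Sum>k<m. F (g (x k)) * (g (s (Suc k)) - g (s k)))"
  define U where "U = (\<Sum>k<Suc m. F (Q k) * (P (Suc k) - P k))"
  define V where "V = (\<Sum>k<Suc m. F (Q k) * (Q (Suc k) - Q k))"
  have UV: "(\<Sum>k<Suc m. F (Q k) * ((P (Suc k) - Q (Suc k)) - (P k - Q k))) = U - V"
    unfolding U_def V_def sum_subtractf[symmetric] by (intro sum.cong refl) (simp add: algebra_simps)
  have T: "T = (T - U) + (U - V) + ?I - (?I - V)" by simp
  have "norm (a + b + c - c') \<le> norm a + norm b + norm c + norm c'" for a b c c' :: complex
    by (intro order_trans[OF norm_triangle_ineq4] add_mono order_trans[OF norm_triangle_ineq] order_refl)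
  then have "norm T \<le> norm (T - U) + norm (U - V) + norm ?I + norm (?I - V)"
    by (subst T) blast
  also have "\<dots> \<le> e2 * B + 3 * e2 * (d * len) + 2 * W * (e1 + 4 * e2 * (1681 * (1 + W)) / \<eta>) + e2 * (d * len)"
    using A1 A2 A3 I unfolding UV T_def[symmetric] U_def[symmetric] V_def[symmetric] by linarith
  also have "\<dots> = e2 * (B + 4 * (d * len)) + 2 * W * (e1 + 4 * e2 * (1681 * (1 + W)) / \<eta>)"
    by (simp add: algebra_simps)
  also have "\<dots> \<le> e2 * (B + 4 * W) + 2 * W * (e1 + 4 * e2 * (1681 * (1 + W)) / \<eta>)"
    using dlen \<open>e2 \<ge> 0\<close> by (intro add_right_mono mult_left_mono) auto
  finally show ?thesis unfolding T_def .
qed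

section \<open>Extension of f and choice of the constants\<close>

text \<open>A continuous extension to the plane need not be uniformly continuous; composing it with
  the 1-Lipschitz nearest-point map onto a ball around K reduces the question to a compact
  set.\<close>

lemma uniformly_continuous_extension:
  fixes f :: "complex \<Rightarrow> complex"
  assumes "compact K" and f: "continuous_on K f"
  obtains F where "uniformly_continuous_on UNIV F" "\<And>z. z \<in> K \<Longrightarrow> F z = f z"
proof -
  have "closedin (top_of_set UNIV) K" using compact_imp_closed[OF assms(1)] by simp
  then obtain h where h: "continuous_on UNIV h" "\<And>z. z \<in> K \<Longrightarrow> h z = f z"
    using Dugundji[of UNIV UNIV K f] f by auto
  obtain r where r: "r > 0" "K \<subseteq> cball 0 r"
    using compact_imp_bounded[OF assms(1)] bounded_subset_ballD ball_subset_cball by (meson order_trans)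
  let ?c = "closest_point (cball (0::complex) r)"
  have "uniformly_continuous_on (cball 0 r) h"
    using h(1) by (intro compact_uniformly_continuous) (auto elim: continuous_on_subset)
  moreover have "?c z \<in> cball 0 r" for z
    using r(1) by (intro closest_point_in_set) auto
  moreover have "dist (?c z) (?c w) \<le> dist z w" for z w
    using r(1) by (intro closest_point_lipschitz) auto
  ultimately have "uniformly_continuous_on UNIV (h \<circ> ?c)"
    unfolding uniformly_continuous_on_def o_apply by (meson order_le_less_trans)
  moreover have "(h \<circ> ?c) z = f z" if "z \<in> K" for z
    using that r(2) h(2) closest_point_self[of z "cball 0 r"] by auto
  ultimately show thesis by (rule that)
qed

theorem mainTheorem2:
  fixes \<gamma> f :: "complex \<Rightarrow> complex" and D :: "complex set"
  assumes "closed_rectifiable_curve \<gamma>"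
    and "D = {z. z \<notin> curve_image \<gamma> \<and> curve_index \<gamma> z \<noteq> 0}"
    and "f holomorphic_on D"
    and "continuous_on (D \<union> curve_image \<gamma>) f"
  shows "(f has_curve_integral 0) \<gamma>"
proof -
  let ?g = "circle_param \<gamma>"
  have g: "path ?g" "?g 1 = ?g 0" "path_image ?g = curve_image \<gamma>"
    using assms(1) circle_param_loop by (auto simp: closed_rectifiable_curve_def)
  have loop: "pathfinish ?g = pathstart ?g" using g(2) by (simp add: pathfinish_def pathstart_def)
  obtain B where B: "\<forall>d. d division_of {0..1} \<longrightarrow> (\<Sum>K\<in>d. norm (?g (Sup K) - ?g (Inf K))) \<le> B"
    using assms(1) by (auto simp: closed_rectifiable_curve_def bounded_variation_on_interval_def)
  have "{{0..1::real}} division_of {0..1}" using division_of_self[of "0::real" 1] by simp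
  from B[rule_format, OF this] have "B \<ge> 0" by (rule order_trans[rotated]) simp
  have D: "D = {z. z \<notin> path_image ?g \<and> winding_number ?g z \<noteq> 0}"
    using curve_index_eq_winding_number[OF assms(1)] unfolding assms(2) g(3) by auto
  \<comment> \<open>The complement is the set of points off the curve with winding number 0, which
    is open and contains a neighbourhood of infinity.\<close>
  have "compact (D \<union> curve_image \<gamma>)"
    unfolding compact_eq_bounded_closed
  proof
    have "bounded D"
      by (rule bounded_subset[OF bounded_winding_number_nz[OF g(1) loop]]) (auto simp: D)
    then show "bounded (D \<union> curve_image \<gamma>)"
      using bounded_path_image[OF g(1)] g(3) by simp
    have "- (D \<union> curve_image \<gamma>) = {z. z \<notin> path_image ?g \<and> winding_number ?g z = 0}"
      unfolding D g(3) by auto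
    then show "closed (D \<union> curve_image \<gamma>)"
      using open_winding_number_levelsets[OF g(1) loop, of 0] by (simp add: closed_def)
  qed
  then obtain F where F: "uniformly_continuous_on UNIV F" "\<And>z. z \<in> D \<union> curve_image \<gamma> \<Longrightarrow> F z = f z"
    using uniformly_continuous_extension assms(4) by blast
  have Fc: "continuous_on UNIV F" using F(1) by (rule uniformly_continuous_imp_continuous)
  have Fh: "F holomorphic_on {z. z \<notin> path_image ?g \<and> winding_number ?g z \<noteq> 0}"
    unfolding D[symmetric] by (rule holomorphic_transform[OF assms(3)]) (simp add: F)
  have unif: "\<exists>\<eta>>0. \<forall>a b. norm (a - b) \<le> \<eta> \<longrightarrow> norm (F a - F b) \<le> e" if e: "e > 0" for e
  proof -
    obtain \<eta> where "\<eta> > 0" "\<forall>a b. dist b a < \<eta> \<longrightarrow> dist (F b) (F a) < e"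
      using F(1) e unfolding uniformly_continuous_on_def by (meson UNIV_I)
    then have "norm (F a - F b) \<le> e" if "norm (a - b) \<le> \<eta> / 2" for a b
      using that by (intro less_imp_le) (simp add: dist_norm)
    then show ?thesis using \<open>\<eta> > 0\<close> by (intro exI[of _ "\<eta> / 2"]) simp
  qed
  define W where "W = 4 * B + 3"
  have "W > 0" using \<open>B \<ge> 0\<close> by (simp add: W_def)
  show ?thesis
    unfolding has_curve_integral_def has_RS_integral_def
  proof (intro allI impI)
    fix e :: real assume "e > 0"
    define e1 where "e1 = e / (8 * W)"
    have "e1 > 0" using \<open>e > 0\<close> \<open>W > 0\<close> by (simp add: e1_def)
    obtain \<eta> where \<eta>: "\<eta> > 0" "\<And>a b. norm (a - b) \<le> \<eta> \<Longrightarrow> norm (F a - F b) \<le> e1"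
      using unif[OF \<open>e1 > 0\<close>] by blast
    \<comment> \<open>C collects the coefficients of \<open>e2\<close> in the bound for the sums and
      contains 1 / \<eta>, so \<open>e2\<close> is chosen only after \<eta>. The factors 8 and 4
      make the contributions of \<open>e1\<close> and \<open>e2\<close> equal to e / 4 each.\<close>
    define C where "C = B + 4 * W + 2 * W * (4 * (1681 * (1 + W)) / \<eta>)"
    have "C > 0" using \<open>B \<ge> 0\<close> \<open>W > 0\<close> \<eta>(1) unfolding C_def by (intro add_nonneg_pos mult_pos_pos divide_pos_pos) auto
    define e2 where "e2 = e / (4 * C)"
    have "e2 > 0" using \<open>e > 0\<close> \<open>C > 0\<close> by (simp add: e2_def)
    obtain \<eta>' where \<eta>': "\<eta>' > 0" "\<And>a b. norm (a - b) \<le> \<eta>' \<Longrightarrow> norm (F a - F b) \<le> e2"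
      using unif[OF \<open>e2 > 0\<close>] by blast
    define d where "d = min 1 (\<eta>' / 8)"
    have d: "0 < d" "d \<le> 1" "8 * d \<le> \<eta>'" using \<eta>'(1) by (auto simp: d_def)
    have "e2 * (B + 4 * W) + 2 * W * (e1 + 4 * e2 * (1681 * (1 + W)) / \<eta>) = e2 * C + 2 * W * e1"
      by (simp add: C_def algebra_simps)
    also have "\<dots> = e / 2"
      using \<open>C > 0\<close> \<open>W > 0\<close> by (simp add: e1_def e2_def)
    finally have total: "e2 * (B + 4 * W) + 2 * W * (e1 + 4 * e2 * (1681 * (1 + W)) / \<eta>) = e / 2" .
    obtain \<delta> where \<delta>: "\<delta> > 0"
      "\<And>s t. s \<in> {0..1} \<Longrightarrow> t \<in> {0..1} \<Longrightarrow> \<bar>s - t\<bar> < \<delta> \<Longrightarrow> norm (?g s - ?g t) < d"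
      using path_uniform[OF g(1) d(1)] by blast
    show "\<exists>\<delta>>0. \<forall>p. p tagged_division_of {0..1} \<and> (\<lambda>x. ball x \<delta>) fine p \<longrightarrow>
       norm ((\<Sum>(x, K)\<in>p. f (?g x) * (?g (Sup K) - ?g (Inf K))) - 0) < e"
    proof (intro exI[of _ "\<delta> / 2"] conjI allI impI; (elim conjE)?)
      show "\<delta> / 2 > 0" using \<delta> by simp
      fix p :: "(real \<times> real set) set"
      assume p: "p tagged_division_of {0..1}" and fine: "(\<lambda>x. ball x (\<delta> / 2)) fine p"
      obtain m s x where s: "s 0 = 0" "s m = 1" "\<And>k. k < m \<Longrightarrow> s k < s (Suc k)"
        "\<And>k. k < m \<Longrightarrow> x k \<in> {s k..s (Suc k)}"
        "\<And>k. k < m \<Longrightarrow> {s k..s (Suc k)} \<subseteq> ball (x k) (\<delta> / 2)"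
        "(\<Sum>k<m. norm (?g (s (Suc k)) - ?g (s k))) \<le> B"
        "\<And>h. (\<Sum>(x, K)\<in>p. h x * (?g (Sup K) - ?g (Inf K))) = (\<Sum>k<m. h (x k) * (?g (s (Suc k)) - ?g (s k)))"
        by (rule fine_tagged_division_sorted[OF p zero_le_one fine B]) (rule that)
      have mono: "s k \<le> s l" if "k \<le> l" "l \<le> m" for k l
        using that
      proof (induction l rule: dec_induct)
        case (step l)
        then show ?case using s(3)[of l] by simp
      qed simp
      have sub: "{s k..s (Suc k)} \<subseteq> {0..1}" if "k < m" for k
        using mono[of 0 k] mono[of "Suc k" m] that s(1,2) by auto
      have osc: "norm (?g \<tau> - ?g (s k)) \<le> d" if "k < m" "\<tau> \<in> {s k..s (Suc k)}" for k \<tau>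
      proof (rule less_imp_le, rule \<delta>(2))
        have sk: "s k \<in> {s k..s (Suc k)}" using s(3)[OF that(1)] by simp
        have "\<tau> \<in> ball (x k) (\<delta> / 2)" "s k \<in> ball (x k) (\<delta> / 2)"
          using subsetD[OF s(5)[OF that(1)]] that(2) sk by blast+
        then show "\<bar>\<tau> - s k\<bar> < \<delta>" unfolding mem_ball dist_real_def by linarith
        show "\<tau> \<in> {0..1}" "s k \<in> {0..1}"
          using subsetD[OF sub[OF that(1)]] that(2) sk by blast+
      qed
      have "(\<Sum>(x, K)\<in>p. f (?g x) * (?g (Sup K) - ?g (Inf K)))
         = (\<Sum>k<m. f (?g (x k)) * (?g (s (Suc k)) - ?g (s k)))"
        by (rule s(7))
      also have "\<dots> = (\<Sum>k<m. F (?g (x k)) * (?g (s (Suc k)) - ?g (s k)))"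
      proof (intro sum.cong refl)
        fix k assume "k \<in> {..<m}"
        then have "x k \<in> {0..1}" using s(4)[of k] sub[of k] by blast
        then have "?g (x k) \<in> curve_image \<gamma>" unfolding g(3)[symmetric] path_image_def by blast
        then show "f (?g (x k)) * (?g (s (Suc k)) - ?g (s k)) = F (?g (x k)) * (?g (s (Suc k)) - ?g (s k))"
          using F(2) by simp
      qed
      also have "norm \<dots> \<le> e / 2"
      proof -
        have "norm (\<Sum>k<m. F (?g (x k)) * (?g (s (Suc k)) - ?g (s k)))
            \<le> e2 * (B + 4 * (4 * B + 3))
              + 2 * (4 * B + 3) * (e1 + 4 * e2 * (1681 * (1 + (4 * B + 3))) / \<eta>)"
        proof (rule norm_curve_sum_le[OF g(1,2) Fc Fh d(1,2) less_imp_le[OF \<open>e1 > 0\<close>] less_imp_le[OF \<open>e2 > 0\<close>] \<eta>(1)])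
          show "norm (F a - F b) \<le> e2" if "norm (a - b) \<le> 8 * d" for a b
            using that d(3) by (intro \<eta>'(2)) simp
        qed (fact \<eta>(2) s(1-4) osc s(6))+
        then show ?thesis using total unfolding W_def by simp
      qed
      finally show "norm ((\<Sum>(x, K)\<in>p. f (?g x) * (?g (Sup K) - ?g (Inf K))) - 0) < e"
        using \<open>e > 0\<close> by simp
    qed
  qed
qed

end
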